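(* Let $(X,\mathcal A,\mu)$ be an isometric target space of the projective system $\{(X_n,\mathcal A_n,\mu_n)\}_{n\in\mathbb N}$ (with mappings $\delta_m^n$, $\delta^n$). For every $n\in\mathbb N$ let $A_n$ be an $\mathcal A_n$-measurable transformation of $X_n$ such that $\mu_n\circ A_n^{-1}\ll\mu_n$, and let $A$ be an $\mathcal A$-measurable transformation of $X$. If for all $k\in\mathbb N$ and all $\sigma\in\mathcal A_k$ $$\lim_{n\to\infty}\mu\Big((\delta_n^k\circ A_n\circ\delta^n)^{-1}(\sigma)\,\triangle\,(\delta^k\circ A)^{-1}(\sigma)\Big)=0$$ and $$\sup_{n\in\mathbb N}\|\mathsf h^{A_n}\|_{L^\infty(\mu_n)}<\infty,$$ then $C_A$ is a bounded operator on $L^2(\mu)$ (defined on all of $L^2(\mu)$) and $C_A=\overline{\mathtt{lim}\,C_{A_n}}$.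
   Context: Notation: $\sigma_1\triangle\sigma_2$ is the symmetric difference; $\overline T$ is the closure of an operator $T$; all operators are linear and possibly unbounded; $L^p$-spaces are complex. Projective systems. A sequence $\{(X_n,\mathcal A_n,\mu_n)\}_{n\in\mathbb N}$ of measure spaces is a projective system if there are surjective mappings $\delta_m^n\colon X_m\to X_n$ ($n\le m$) such that each $\delta_m^n$ is $(\mathcal A_m,\mathcal A_n)$-measurable, $\delta_k^n=\delta_m^n\circ\delta_k^m$ for $n\le m\le k$, and $\delta_n^n$ is the identity. A measure space $(X,\mathcal A,\mu)$ is a target space of it if there are surjective mappings $\delta^n\colon X\to X_n$ such that each $\delta^n$ is $(\mathcal A,\mathcal A_n)$-measurable, $\delta^n=\delta_m^n\circ\delta^m$ for $n\le m$, $\mathcal A$ is the $\sigma$-algebra generated by $\{(\delta^n)^{-1}(\sigma)\colon \sigma\in\mathcal A_n,\ n\in\mathbb N\}$, and $\mu((\delta^n)^{-1}(\sigma))=\lim_{m\to\infty}\mu_m((\delta_m^n)^{-1}(\sigma))$ for all $\sigma\in\mathcal A_n$, $n\in\mathbb N$. The target space is isometric if, for every $k\in\mathbb N$, $\mu_k$ is $\sigma$-finite, $\mu\circ(\delta^k)^{-1}\ll\mu_k$ with $\frac{d\mu\circ(\delta^k)^{-1}}{d\mu_k}\in L^\infty(\mu_k)$, and the operator $\Delta_k\colon L^2(\mu_k)\ni f\mapsto f\circ\delta^k\in L^2(\mu)$ is an isometry. Then the operators $\Delta_k^l\colon L^2(\mu_k)\ni f\mapsto f\circ\delta_l^k\in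 L^2(\mu_l)$ ($k\le l$) are also isometries. Composition operators. For a $\sigma$-finite measure space $(Y,\mathcal B,\nu)$ and a $\mathcal B$-measurable $T\colon Y\to Y$, let $\nu\circ T^{-1}(\sigma)=\nu(T^{-1}(\sigma))$. $T$ is nonsingular if $\nu\circ T^{-1}\ll\nu$; then $\mathsf h^T=\frac{d\nu\circ T^{-1}}{d\nu}$ and $C_T$ is the (well-defined) operator in $L^2(\nu)$ with domain $\{f\in L^2(\nu)\colon f\circ T\in L^2(\nu)\}$ and $C_Tf=f\circ T$. Assertions about $C_A$ include the assertion that $A$ is nonsingular, so that $C_A$ is well defined. Inductive limit of operators. For operators $C_n$ in $L^2(\mu_n)$, let $D_\infty=\bigcup_{k}\{\Delta_kf\colon f\in L^2(\mu_k),\ \exists M\ge k\ \forall m\ge M\colon \Delta_k^mf\in \mathrm D(C_m)\}$. The operator $\mathtt{lim}\,C_n$ in $L^2(\mu)$ has domain $\{\Delta_kf\in D_\infty\colon \lim_{m\to\infty}\Delta_mC_m\Delta_k^mf\text{ exists in }L^2(\mu)\}$ and acts by $(\mathtt{lim}\,C_n)\Delta_kf=\lim_{m\to\infty}\Delta_mC_m\Delta_k^mf$. *)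

theory Defs
  imports "HOL-Probability.Probability"
begin

subsection \<open>The space L2 of a measure\<close>

definition square_integrable :: "'a measure \<Rightarrow> ('a \<Rightarrow> complex) \<Rightarrow> bool" where
  "square_integrable M f \<longleftrightarrow>
     f \<in> borel_measurable M \<and> integrable M (\<lambda>x. (cmod (f x))\<^sup>2)"

definition ae_class :: "'a measure \<Rightarrow> ('a \<Rightarrow> complex) \<Rightarrow> ('a \<Rightarrow> complex) set" where
  "ae_class M f = {g. square_integrable M g \<and> (AE x in M. f x = g x)}"

definition L2 :: "'a measure \<Rightarrow> ('a \<Rightarrow> complex) set set" where
  "L2 M = ae_class M ` {f. square_integrable M f}"

definition rep :: "('a \<Rightarrow> complex) set \<Rightarrow> 'a \<Rightarrow> complex" where
  "rep F = (SOME f. f \<in> F)"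

definition seminorm2 :: "'a measure \<Rightarrow> ('a \<Rightarrow> complex) \<Rightarrow> real" where
  "seminorm2 M f = sqrt (\<integral>x. (cmod (f x))\<^sup>2 \<partial>M)"

definition L2_norm :: "'a measure \<Rightarrow> ('a \<Rightarrow> complex) set \<Rightarrow> real" where
  "L2_norm M F = seminorm2 M (rep F)"

definition L2_dist ::
  "'a measure \<Rightarrow> ('a \<Rightarrow> complex) set \<Rightarrow> ('a \<Rightarrow> complex) set \<Rightarrow> real" where
  "L2_dist M F G = seminorm2 M (\<lambda>x. rep F x - rep G x)"

definition L2_topology :: "'a measure \<Rightarrow> ('a \<Rightarrow> complex) set topology" where
  "L2_topology M = Metric_space.mtopology (L2 M) (L2_dist M)"

lemma square_integrable_diff:
  assumes f: "square_integrable M f" and g: "square_integrable M g"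
  shows "square_integrable M (\<lambda>x. f x - g x)"
proof -
  have [measurable]: "f \<in> borel_measurable M" "g \<in> borel_measurable M"
    using assms by (auto simp: square_integrable_def)
  have "integrable M (\<lambda>x. 2 * (cmod (f x))\<^sup>2 + 2 * (cmod (g x))\<^sup>2)"
    using assms by (auto simp: square_integrable_def)
  moreover have "(cmod (f x - g x))\<^sup>2 \<le> 2 * (cmod (f x))\<^sup>2 + 2 * (cmod (g x))\<^sup>2" for x
  proof -
    have "(cmod (f x - g x))\<^sup>2 \<le> (cmod (f x) + cmod (g x))\<^sup>2"
      by (intro power_mono norm_triangle_ineq4) auto
    also have "\<dots> \<le> 2 * (cmod (f x))\<^sup>2 + 2 * (cmod (g x))\<^sup>2"
      using sum_squares_bound[of "cmod (f x)" "cmod (g x)"] by (simp add: power2_sum)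
    finally show ?thesis .
  qed
  ultimately have "integrable M (\<lambda>x. (cmod (f x - g x))\<^sup>2)"
    by (elim Bochner_Integration.integrable_bound) auto
  then show ?thesis by (simp add: square_integrable_def)
qed

lemma seminorm2_triangle:
  assumes f: "square_integrable M f" and g: "square_integrable M g"
    and le: "\<And>x. cmod (h x) \<le> cmod (f x) + cmod (g x)"
    and h: "square_integrable M h"
  shows "seminorm2 M h \<le> seminorm2 M f + seminorm2 M g"
proof -
  define a where "a = seminorm2 M f"
  define b where "b = seminorm2 M g"
  have a0: "a \<ge> 0" "b \<ge> 0" by (auto simp: a_def b_def seminorm2_def)
  have a2: "(\<integral>x. (cmod (f x))\<^sup>2 \<partial>M) = a\<^sup>2" and b2: "(\<integral>x. (cmod (g x))\<^sup>2 \<partial>M) = b\<^sup>2"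
    by (auto simp: a_def b_def seminorm2_def)
  have int: "integrable M (\<lambda>x. (cmod (f x))\<^sup>2)" "integrable M (\<lambda>x. (cmod (g x))\<^sup>2)"
      "integrable M (\<lambda>x. (cmod (h x))\<^sup>2)"
    using f g h by (auto simp: square_integrable_def)
  have key: "seminorm2 M h \<le> p + q" if p: "p > a" and q: "q > b" for p q
  proof -
    have pq: "p > 0" "q > 0" using p q a0 by auto
    have pt: "(cmod (h x))\<^sup>2 \<le> (1 + q / p) * (cmod (f x))\<^sup>2 + (1 + p / q) * (cmod (g x))\<^sup>2" for x
    proof -
      let ?u = "cmod (f x)" and ?v = "cmod (g x)"
      have "(cmod (h x))\<^sup>2 \<le> (?u + ?v)\<^sup>2" by (intro power_mono le) auto
      also have "\<dots> \<le> (1 + q / p) * ?u\<^sup>2 + (1 + p / q) * ?v\<^sup>2"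
      proof -
        have "0 \<le> (q * ?u - p * ?v)\<^sup>2 / (p * q)" using pq by simp
        also have "\<dots> = q / p * ?u\<^sup>2 + p / q * ?v\<^sup>2 - 2 * ?u * ?v"
          using pq by (simp add: field_simps power2_eq_square)
        finally show ?thesis by (simp add: power2_sum algebra_simps)
      qed
      finally show ?thesis .
    qed
    have "(\<integral>x. (cmod (h x))\<^sup>2 \<partial>M)
        \<le> (\<integral>x. (1 + q / p) * (cmod (f x))\<^sup>2 + (1 + p / q) * (cmod (g x))\<^sup>2 \<partial>M)"
      using int pt by (intro integral_mono) auto
    also have "\<dots> = (1 + q / p) * a\<^sup>2 + (1 + p / q) * b\<^sup>2"
      using int by (simp add: a2 b2)
    also have "\<dots> \<le> (1 + q / p) * p\<^sup>2 + (1 + p / q) * q\<^sup>2"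
      using pq a0 p q by (intro add_mono mult_left_mono power_mono) auto
    also have "\<dots> = (p + q)\<^sup>2"
      using pq by (simp add: field_simps power2_eq_square)
    finally show ?thesis
      unfolding seminorm2_def using pq by (intro real_le_lsqrt) auto
  qed
  have "seminorm2 M h \<le> a + b + e" if "e > 0" for e
    using key[of "a + e / 2" "b + e / 2"] that by simp
  then show ?thesis unfolding a_def b_def by (rule field_le_epsilon)
qed

lemma ae_class_cong:
  assumes "AE x in M. f x = g x"
  shows "ae_class M f = ae_class M g"
proof -
  have "(AE x in M. f x = h x) \<longleftrightarrow> (AE x in M. g x = h x)" for h
  proof
    assume "AE x in M. f x = h x"
    with assms show "AE x in M. g x = h x" by eventually_elim simp
  next
    assume "AE x in M. g x = h x"
    with assms show "AE x in M. f x = h x" by eventually_elim simp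
  qed
  then show ?thesis unfolding ae_class_def by blast
qed

lemma rep_L2:
  assumes "F \<in> L2 M"
  shows "rep F \<in> F" "square_integrable M (rep F)" "F = ae_class M (rep F)"
proof -
  obtain f where f: "square_integrable M f" "F = ae_class M f"
    using assms by (auto simp: L2_def)
  then have "f \<in> F" by (auto simp: ae_class_def)
  then show r: "rep F \<in> F" unfolding rep_def by (rule someI[of "\<lambda>f. f \<in> F"])
  then show "square_integrable M (rep F)" using f by (auto simp: ae_class_def)
  have ae: "AE x in M. f x = rep F x" using r f by (auto simp: ae_class_def)
  have "ae_class M f = ae_class M (rep F)"
    using ae by (rule ae_class_cong)
  with f(2) show "F = ae_class M (rep F)" by (rule trans)
qed

lemma Metric_space_L2: "Metric_space (L2 M) (L2_dist M)"
proof
  fix F G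
  show "0 \<le> L2_dist M F G" by (simp add: L2_dist_def seminorm2_def)
  show "L2_dist M F G = L2_dist M G F"
    by (simp add: L2_dist_def seminorm2_def norm_minus_commute)
next
  fix F G assume F: "F \<in> L2 M" and G: "G \<in> L2 M"
  have "integrable M (\<lambda>x. (cmod (rep F x - rep G x))\<^sup>2)"
    using square_integrable_diff[OF rep_L2(2)[OF F] rep_L2(2)[OF G]]
    by (simp add: square_integrable_def)
  then have *: "L2_dist M F G = 0 \<longleftrightarrow> (AE x in M. rep F x = rep G x)"
    by (simp add: L2_dist_def seminorm2_def integral_nonneg_eq_0_iff_AE)
  have "(AE x in M. rep F x = rep G x) \<longleftrightarrow> F = G"
  proof
    assume "AE x in M. rep F x = rep G x"
    then have "ae_class M (rep F) = ae_class M (rep G)"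
      by (rule ae_class_cong)
    then show "F = G" by (metis rep_L2(3) F G)
  qed auto
  with * show "L2_dist M F G = 0 \<longleftrightarrow> F = G" by simp
next
  fix F G H assume F: "F \<in> L2 M" and G: "G \<in> L2 M" and H: "H \<in> L2 M"
  note r = rep_L2(2)[OF F] rep_L2(2)[OF G] rep_L2(2)[OF H]
  show "L2_dist M F H \<le> L2_dist M F G + L2_dist M G H"
    unfolding L2_dist_def
  proof (rule seminorm2_triangle)
    show "cmod (rep F x - rep H x) \<le> cmod (rep F x - rep G x) + cmod (rep G x - rep H x)" for x
      using norm_triangle_ineq[of "rep F x - rep G x" "rep G x - rep H x"] by simp
  qed (intro square_integrable_diff r)+
qed

subsection \<open>Operators\<close>

text \<open>
  A possibly unbounded operator between L2 spaces is a partial map on equivalence classes, whose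
  \<^const>\<open>dom\<close> is the domain of the operator and whose \<^const>\<open>Map.graph\<close> is its graph.
  Linearity is not built into the type: composition operators and their limits are linear.
\<close>

type_synonym ('a, 'b) L2_operator = "('a \<Rightarrow> complex) set \<rightharpoonup> ('b \<Rightarrow> complex) set"

definition isometry_L2 :: "'a measure \<Rightarrow> 'b measure \<Rightarrow> ('a, 'b) L2_operator \<Rightarrow> bool" where
  "isometry_L2 M N T \<longleftrightarrow>
     dom T = L2 M \<and> ran T \<subseteq> L2 N \<and> (\<forall>F\<in>L2 M. L2_norm N (the (T F)) = L2_norm M F)"

definition bounded_on_L2 :: "'a measure \<Rightarrow> ('a, 'a) L2_operator \<Rightarrow> bool" where
  "bounded_on_L2 M T \<longleftrightarrow>
     dom T = L2 M \<and> ran T \<subseteq> L2 M \<and> (\<exists>c. \<forall>F\<in>L2 M. L2_norm M (the (T F)) \<le> c * L2_norm M F)"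

definition closure_graph :: "'a measure \<Rightarrow> ('a, 'a) L2_operator \<Rightarrow>
    (('a \<Rightarrow> complex) set \<times> ('a \<Rightarrow> complex) set) set" where
  "closure_graph M T = prod_topology (L2_topology M) (L2_topology M) closure_of Map.graph T"

text \<open>
  Saying that the closure of the graph of \<open>T\<close> is the graph of the map \<open>S\<close> includes the
  assertion that \<open>T\<close> is closable.
\<close>

definition is_operator_closure ::
  "'a measure \<Rightarrow> ('a, 'a) L2_operator \<Rightarrow> ('a, 'a) L2_operator \<Rightarrow> bool" where
  "is_operator_closure M S T \<longleftrightarrow> Map.graph S = closure_graph M T"

text \<open>
  \<open>comp_op M N \<phi>\<close> is the operator \<open>f \<mapsto> f \<circ> \<phi>\<close> from L2 of \<open>M\<close> to L2 of \<open>N\<close> with its maximal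
  domain. It is independent of the choice of representatives when \<open>\<phi>\<close> is measurable and the
  image of \<open>N\<close> under \<open>\<phi>\<close> is absolutely continuous with respect to \<open>M\<close>.
\<close>

definition comp_op :: "'a measure \<Rightarrow> 'b measure \<Rightarrow> ('b \<Rightarrow> 'a) \<Rightarrow> ('a, 'b) L2_operator" where
  "comp_op M N \<phi> = (\<lambda>F.
     if F \<in> L2 M \<and> square_integrable N (rep F \<circ> \<phi>)
     then Some (ae_class N (rep F \<circ> \<phi>)) else None)"

lemma comp_op_eq:
  assumes \<phi>: "\<phi> \<in> N \<rightarrow>\<^sub>M M" and ac: "absolutely_continuous M (distr N M \<phi>)"
    and f: "square_integrable M f"
  shows "comp_op M N \<phi> (ae_class M f) =
    (if square_integrable N (f \<circ> \<phi>) then Some (ae_class N (f \<circ> \<phi>)) else None)"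
proof -
  define F where "F = ae_class M f"
  have F: "F \<in> L2 M" using f by (auto simp: F_def L2_def)
  note r = rep_L2[OF F]
  have "AE x in M. f x = rep F x"
    using r(1) by (auto simp: F_def ae_class_def)
  then have "AE x in distr N M \<phi>. f x = rep F x"
    using ac absolutely_continuous_AE[of "distr N M \<phi>" M] by simp
  then have ae: "AE x in N. f (\<phi> x) = rep F (\<phi> x)"
    using \<phi> by (rule AE_distrD[rotated])
  have [measurable]: "f \<in> borel_measurable M" "rep F \<in> borel_measurable M"
    using f r by (auto simp: square_integrable_def)
  note [measurable] = \<phi>
  have "integrable N (\<lambda>x. (cmod (f (\<phi> x)))\<^sup>2) \<longleftrightarrow> integrable N (\<lambda>x. (cmod (rep F (\<phi> x)))\<^sup>2)"
  proof (rule integrable_cong_AE)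
    show "AE x in N. (cmod (f (\<phi> x)))\<^sup>2 = (cmod (rep F (\<phi> x)))\<^sup>2"
      using ae by eventually_elim simp
  qed measurable
  then have 1: "square_integrable N (f \<circ> \<phi>) \<longleftrightarrow> square_integrable N (rep F \<circ> \<phi>)"
    unfolding square_integrable_def o_def by simp
  have 2: "ae_class N (f \<circ> \<phi>) = ae_class N (rep F \<circ> \<phi>)"
    using ae by (intro ae_class_cong) simp
  show ?thesis
    using F 1 2 unfolding comp_op_def F_def[symmetric] by auto
qed

definition nonsingular :: "'a measure \<Rightarrow> ('a \<Rightarrow> 'a) \<Rightarrow> bool" where
  "nonsingular M T \<longleftrightarrow> absolutely_continuous M (distr M M T)"

definition RN_density :: "'a measure \<Rightarrow> ('a \<Rightarrow> 'a) \<Rightarrow> 'a \<Rightarrow> ennreal" where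
  "RN_density M T = RN_deriv M (distr M M T)"

abbreviation composition_operator :: "'a measure \<Rightarrow> ('a \<Rightarrow> 'a) \<Rightarrow> ('a, 'a) L2_operator" where
  "composition_operator M T \<equiv> comp_op M M T"

subsection \<open>Projective systems and target spaces\<close>

text \<open>
  The underlying sets of the \<open>X n\<close> are sets in one common type (a disjoint union of arbitrary sets
  serves as such a type). The mapping from \<open>X m\<close> to \<open>X n\<close>, where \<open>n \<le> m\<close>, is \<open>\<delta> n m\<close>.
\<close>

locale projective_measure_system =
  fixes X :: "nat \<Rightarrow> 'a measure" and \<delta> :: "nat \<Rightarrow> nat \<Rightarrow> 'a \<Rightarrow> 'a"
  assumes \<delta>_measurable: "\<And>n m. n \<le> m \<Longrightarrow> \<delta> n m \<in> X m \<rightarrow>\<^sub>M X n"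
    and \<delta>_surj: "\<And>n m. n \<le> m \<Longrightarrow> \<delta> n m ` space (X m) = space (X n)"
    and \<delta>_comp: "\<And>n m k x. n \<le> m \<Longrightarrow> m \<le> k \<Longrightarrow> x \<in> space (X k) \<Longrightarrow> \<delta> n k x = \<delta> n m (\<delta> m k x)"
    and \<delta>_id: "\<And>n x. x \<in> space (X n) \<Longrightarrow> \<delta> n n x = x"

locale measure_target_space = projective_measure_system X \<delta>
  for X :: "nat \<Rightarrow> 'a measure" and \<delta> :: "nat \<Rightarrow> nat \<Rightarrow> 'a \<Rightarrow> 'a" +
  fixes Y :: "'b measure" and \<epsilon> :: "nat \<Rightarrow> 'b \<Rightarrow> 'a"
  assumes \<epsilon>_measurable: "\<And>n. \<epsilon> n \<in> Y \<rightarrow>\<^sub>M X n"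
    and \<epsilon>_surj: "\<And>n. \<epsilon> n ` space Y = space (X n)"
    and \<epsilon>_comp: "\<And>n m y. n \<le> m \<Longrightarrow> y \<in> space Y \<Longrightarrow> \<epsilon> n y = \<delta> n m (\<epsilon> m y)"
    and sets_target: "sets Y = sigma_sets (space Y) {\<epsilon> n -` \<sigma> \<inter> space Y | n \<sigma>. \<sigma> \<in> sets (X n)}"
    and emeasure_target: "\<And>n \<sigma>. \<sigma> \<in> sets (X n) \<Longrightarrow>
      (\<lambda>m. emeasure (X m) (\<delta> n m -` \<sigma> \<inter> space (X m))) \<longlonglongrightarrow> emeasure Y (\<epsilon> n -` \<sigma> \<inter> space Y)"

locale isometric_target_space = measure_target_space X \<delta> Y \<epsilon>
  for X :: "nat \<Rightarrow> 'a measure" and \<delta> :: "nat \<Rightarrow> nat \<Rightarrow> 'a \<Rightarrow> 'a"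
    and Y :: "'b measure" and \<epsilon> :: "nat \<Rightarrow> 'b \<Rightarrow> 'a" +
  assumes sigma_finite: "\<And>k. sigma_finite_measure (X k)"
    and abs_cont: "\<And>k. absolutely_continuous (X k) (distr Y (X k) (\<epsilon> k))"
    and density_bounded: "\<And>k. esssup (X k) (RN_deriv (X k) (distr Y (X k) (\<epsilon> k))) < \<infinity>"
    and \<Delta>_isometry: "\<And>k. isometry_L2 (X k) Y (comp_op (X k) Y (\<epsilon> k))"

subsection \<open>Inductive limits of operators\<close>

text \<open>
  In the next definition \<open>\<Delta> k\<close> and \<open>\<Delta>' k m\<close> are the canonical embeddings of L2 of \<open>X k\<close> into L2 of
  \<open>Y\<close> and of \<open>X m\<close>; the relation holds of \<open>G\<close> and \<open>H\<close> if \<open>G\<close> is in the domain of the inductive limit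
  of the operators \<open>C m\<close> and \<open>H\<close> is its image.
\<close>

definition has_inductive_limit ::
  "(nat \<Rightarrow> 'a measure) \<Rightarrow> (nat \<Rightarrow> nat \<Rightarrow> 'a \<Rightarrow> 'a) \<Rightarrow> 'b measure \<Rightarrow> (nat \<Rightarrow> 'b \<Rightarrow> 'a) \<Rightarrow>
    (nat \<Rightarrow> ('a, 'a) L2_operator) \<Rightarrow> ('b \<Rightarrow> complex) set \<Rightarrow> ('b \<Rightarrow> complex) set \<Rightarrow> bool" where
  "has_inductive_limit X \<delta> Y \<epsilon> C G H \<longleftrightarrow>
     (let \<Delta> = (\<lambda>k F. the (comp_op (X k) Y (\<epsilon> k) F));
          \<Delta>' = (\<lambda>k m F. the (comp_op (X k) (X m) (\<delta> k m) F))
      in \<exists>k. \<exists>F\<in>L2 (X k). G = \<Delta> k F \<and>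
           (\<exists>m\<^sub>0\<ge>k. \<forall>m\<ge>m\<^sub>0. \<Delta>' k m F \<in> dom (C m)) \<and>
           limitin (L2_topology Y) (\<lambda>m. \<Delta> m (the (C m (\<Delta>' k m F)))) H sequentially)"

definition inductive_limit ::
  "(nat \<Rightarrow> 'a measure) \<Rightarrow> (nat \<Rightarrow> nat \<Rightarrow> 'a \<Rightarrow> 'a) \<Rightarrow> 'b measure \<Rightarrow> (nat \<Rightarrow> 'b \<Rightarrow> 'a) \<Rightarrow>
    (nat \<Rightarrow> ('a, 'a) L2_operator) \<Rightarrow> ('b, 'b) L2_operator" where
  "inductive_limit X \<delta> Y \<epsilon> C = (\<lambda>G.
     if \<exists>H. has_inductive_limit X \<delta> Y \<epsilon> C G H
     then Some (THE H. has_inductive_limit X \<delta> Y \<epsilon> C G H) else None)"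

end

theory Submission
  imports Defs
begin

text \<open>
  The isometry assumption, read on indicator functions, says that the maps \<open>\<epsilon> k\<close> and \<open>\<delta> k m\<close> preserve
  measures. The uniform bound on the densities gives a constant \<open>c\<close> such that the image measure of each
  \<open>A n\<close> is at most \<open>c\<close> times the measure of its level; hence all the maps \<open>\<delta> k n \<circ> A n \<circ> \<epsilon> n\<close> from the
  target space to level \<open>k\<close> satisfy the same domination. Letting \<open>n\<close> tend to infinity, the convergence
  of preimages transfers it to \<open>\<epsilon> k \<circ> B\<close>, that is, to the action of \<open>B\<close> on cylinder sets. Cylinders form
  an algebra that generates the target \<open>\<sigma>\<close>-algebra, so the image measure of \<open>B\<close> itself is at most \<open>c\<close>
  times the measure of the target space (\<open>distr_B\<close>). Therefore \<open>B\<close> is nonsingular and composition with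
  \<open>B\<close> is a bounded everywhere defined operator of norm at most \<open>sqrt c\<close>.

  For a square integrable function \<open>f\<close> at level \<open>k\<close>, the operators whose limit is taken send \<open>f\<close> to
  \<open>f \<circ> (\<delta> k n \<circ> A n \<circ> \<epsilon> n)\<close>, and the candidate limit is \<open>f \<circ> (\<epsilon> k \<circ> B)\<close>. For indicators the distance of
  the two is the square root of the measure of a symmetric difference of preimages, which tends to 0.
  Uniform boundedness by \<open>sqrt c\<close> extends convergence to all \<open>f\<close> (\<open>level_functions_converge\<close>). So the
  inductive limit is precisely the restriction of the composition operator of \<open>B\<close> to the classes of
  functions \<open>f \<circ> \<epsilon> k\<close> (\<open>inductive_limit_eq_restriction\<close>). These are dense, since every set of finite
  measure is approximated by cylinders (\<open>level_classes_dense\<close>), and the closure of the restriction of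
  a bounded operator to a dense set is that operator (\<open>is_operator_closure_restrict_dense\<close>).
\<close>

section \<open>Approximation of measurable sets by an algebra\<close>

text \<open>
  The sets that can be approximated contain the algebra and are closed under complements and
  countable unions: for a union, finitely many members already fill it up to a small measure by
  continuity, and each of these is approximated with an error from a geometric series. One set \<open>U\<close>
  serves all measures of the finite family \<open>\<K>\<close> at once, which is what makes it possible to compare
  two measures below.
\<close>

lemma algebra_approximates_sigma_algebra:
  assumes alg: "algebra \<Omega> \<C>" and "finite \<K>"
    and fin: "\<And>K. K \<in> \<K> \<Longrightarrow> finite_measure K"
    and sets: "\<And>K. K \<in> \<K> \<Longrightarrow> sets K = sigma_sets \<Omega> \<C>"
    and "S \<in> sigma_sets \<Omega> \<C>" and "e > 0"
  shows "\<exists>U\<in>\<C>. \<forall>K\<in>\<K>. measure K (sym_diff S U) < e"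
  using assms(5,6)
proof (induction arbitrary: e)
  case (Basic a)
  then show ?case by (intro bexI[of _ a]) auto
next
  case Empty
  then show ?case using algebra.axioms(1)[OF alg]
    by (intro bexI[of _ "{}"]) (auto simp: ring_of_sets_def semiring_of_sets_def semiring_of_sets_axioms_def)
next
  case (Compl a)
  interpret algebra \<Omega> \<C> by fact
  obtain U where U: "U \<in> \<C>" "\<forall>K\<in>\<K>. measure K (sym_diff a U) < e"
    using Compl by blast
  have "a \<subseteq> \<Omega>" "U \<subseteq> \<Omega>"
    using sigma_sets_into_sp[OF space_closed Compl.hyps] U(1) space_closed by auto
  then have "sym_diff (\<Omega> - a) (\<Omega> - U) = sym_diff a U" by auto
  then show ?case using U by (intro bexI[of _ "\<Omega> - U"]) auto
next
  case (Union S)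
  interpret algebra \<Omega> \<C> by fact
  \<comment> \<open>half of the error is spent on the finitely many approximations, half on the tail of the union\<close>
  define r where "r i = e / 2 * (1 / 2) ^ Suc i" for i :: nat
  have "\<exists>U\<in>\<C>. \<forall>K\<in>\<K>. measure K (sym_diff (S i) U) < r i" for i
    using Union.IH[of "r i" i] Union.prems by (simp add: r_def)
  then obtain U where U: "\<And>i. U i \<in> \<C>"
    and less: "\<And>i K. K \<in> \<K> \<Longrightarrow> measure K (sym_diff (S i) (U i)) < r i"
    by metis
  have sum_r: "(\<Sum>i<n. r i) \<le> e / 2" for n
  proof -
    have "(\<Sum>i<n. (1 / 2 :: real) ^ Suc i) \<le> 1"
      using sum_le_suminf[OF sums_summable[OF power_half_series], of "{..<n}"]
        sums_unique[OF power_half_series] by simp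
    then show ?thesis
      unfolding r_def sum_distrib_left[symmetric] using Union.prems by simp
  qed
  have tail: "(\<lambda>n. measure K ((\<Union>i. S i) - (\<Union>i<n. S i))) \<longlonglongrightarrow> 0" if K: "K \<in> \<K>" for K
  proof -
    interpret finite_measure K by (rule fin[OF K])
    have [measurable]: "S i \<in> sets K" for i using Union.hyps sets[OF K] by auto
    have "(\<lambda>n. measure K ((\<Union>i. S i) - (\<Union>i<n. S i)))
        \<longlonglongrightarrow> measure K (\<Inter>n. (\<Union>i. S i) - (\<Union>i<n. S i))"
      by (intro finite_Lim_measure_decseq) (auto simp: decseq_def)
    also have "(\<Inter>n. (\<Union>i. S i) - (\<Union>i<n. S i)) = {}" by auto
    finally show ?thesis by simp
  qed
  have "\<forall>\<^sub>F n in sequentially. \<forall>K\<in>\<K>. measure K ((\<Union>i. S i) - (\<Union>i<n. S i)) < e / 2"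
    using tail Union.prems \<open>finite \<K>\<close>
    by (intro eventually_ball_finite ballI order_tendstoD(2)[where y = 0]) auto
  then obtain n where n: "\<And>K. K \<in> \<K> \<Longrightarrow> measure K ((\<Union>i. S i) - (\<Union>i<n. S i)) < e / 2"
    by (auto simp: eventually_sequentially)
  have "measure K (sym_diff (\<Union>i. S i) (\<Union>i<n. U i)) < e" if K: "K \<in> \<K>" for K
  proof -
    interpret finite_measure K by (rule fin[OF K])
    have [measurable]: "S i \<in> sets K" "U i \<in> sets K" for i
      using Union.hyps U sets[OF K] by auto
    have "measure K (sym_diff (\<Union>i. S i) (\<Union>i<n. U i))
        \<le> measure K (((\<Union>i. S i) - (\<Union>i<n. S i)) \<union> (\<Union>i<n. sym_diff (S i) (U i)))"
      by (intro finite_measure_mono) auto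
    also have "\<dots> \<le> measure K ((\<Union>i. S i) - (\<Union>i<n. S i))
        + measure K (\<Union>i<n. sym_diff (S i) (U i))"
      by (intro measure_Un_le) auto
    also have "\<dots> \<le> measure K ((\<Union>i. S i) - (\<Union>i<n. S i))
        + (\<Sum>i<n. measure K (sym_diff (S i) (U i)))"
      by (intro add_left_mono measure_UNION_le) auto
    also have "\<dots> \<le> measure K ((\<Union>i. S i) - (\<Union>i<n. S i)) + (\<Sum>i<n. r i)"
      using less[OF K] by (intro add_left_mono sum_mono) (auto intro: less_imp_le)
    also have "\<dots> < e" using n[OF K] sum_r[of n] by simp
    finally show ?thesis .
  qed
  moreover have "(\<Union>i<n. U i) \<in> \<C>" using U by auto
  ultimately show ?case by blast
qed

text \<open>
  An inequality between measures does not pass to complements, so Dynkin's argument is of no use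
  here. Instead, on each piece \<open>E i\<close> of finite measure a set is replaced by a member of the algebra
  that is close to it in both measures simultaneously.
\<close>

lemma le_measure_if_le_on_algebra:
  assumes alg: "algebra \<Omega> \<C>" and M: "sets M = sigma_sets \<Omega> \<C>" and N: "sets N = sigma_sets \<Omega> \<C>"
    and le: "\<And>U. U \<in> \<C> \<Longrightarrow> emeasure M U \<le> emeasure N U"
    and E: "incseq E" "\<And>i::nat. E i \<in> \<C>" "(\<Union>i. E i) = \<Omega>" "\<And>i. emeasure N (E i) \<noteq> \<infinity>"
  shows "M \<le> N"
proof -
  interpret algebra \<Omega> \<C> by fact
  have sp: "space M = \<Omega>" "space N = \<Omega>"
    using sets_eq_imp_space_eq[of M "sigma \<Omega> \<C>"] sets_eq_imp_space_eq[of N "sigma \<Omega> \<C>"] M N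
      space_closed by auto
  have "emeasure M S \<le> emeasure N S" for S
  proof (cases "S \<in> sets M")
    case False
    then show ?thesis by (simp add: emeasure_notin_sets)
  next
    case True
    then have S: "S \<in> sigma_sets \<Omega> \<C>" by (simp add: M)
    have [measurable]: "S \<in> sets M" "S \<in> sets N" "E i \<in> sets M" "E i \<in> sets N" for i
      using S E(2) by (auto simp: M N)
    have part: "emeasure M (E i \<inter> S) \<le> emeasure N (E i \<inter> S)" for i
    proof -
      define M' where "M' = density M (indicator (E i))"
      define N' where "N' = density N (indicator (E i))"
      have emM: "emeasure M' U = emeasure M (E i \<inter> U)" and emN: "emeasure N' U = emeasure N (E i \<inter> U)"
        if "U \<in> sigma_sets \<Omega> \<C>" for U
        using that by (auto simp: M'_def N'_def M N intro!: emeasure_restricted sigma_sets.Basic E)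
      have s: "sets M' = sigma_sets \<Omega> \<C>" "sets N' = sigma_sets \<Omega> \<C>"
        by (auto simp: M'_def N'_def M N)
      \<comment> \<open>finiteness of \<open>M\<close> on \<open>E i\<close> comes from the inequality itself\<close>
    have fin: "emeasure N (E i) < \<infinity>" "emeasure M (E i) < \<infinity>"
        using E(4)[of i] le[OF E(2), of i] by (auto simp: less_top[symmetric] top_unique)
      have EO: "E i \<inter> \<Omega> = E i" using E(3) by auto
      interpret M': finite_measure M'
        using fin EO emM[OF sigma_sets_top] by (intro finite_measureI) (simp add: M'_def sp)
      interpret N': finite_measure N'
        using fin EO emN[OF sigma_sets_top] by (intro finite_measureI) (simp add: N'_def sp)
      have "measure M' S \<le> measure N' S + d" if "d > 0" for d
      proof -
        obtain U where U: "U \<in> \<C>" "measure M' (sym_diff S U) < d / 2" "measure N' (sym_diff S U) < d / 2"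
          using algebra_approximates_sigma_algebra[OF alg, of "{M', N'}" S "d / 2"] S s \<open>d > 0\<close>
            M'.finite_measure_axioms N'.finite_measure_axioms by auto
        have [measurable]: "U \<in> sets M'" "U \<in> sets N'" "S \<in> sets M'" "S \<in> sets N'"
          using U(1) S by (auto simp: s)
        have "emeasure M' U \<le> emeasure N' U"
          using U(1) E(2) by (auto simp: emM emN intro!: le)
        then have "measure M' U \<le> measure N' U"
          by (simp add: M'.emeasure_eq_measure N'.emeasure_eq_measure)
        moreover have "measure M' S \<le> measure M' U + measure M' (sym_diff S U)"
          by (rule order_trans[OF M'.finite_measure_mono measure_Un_le]) auto
        moreover have "measure N' U \<le> measure N' S + measure N' (sym_diff S U)"
          by (rule order_trans[OF N'.finite_measure_mono measure_Un_le]) auto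
        ultimately show ?thesis using U(2,3) by simp
      qed
      then have "measure M' S \<le> measure N' S" by (rule field_le_epsilon)
      then have "emeasure M' S \<le> emeasure N' S"
        by (simp add: M'.emeasure_eq_measure N'.emeasure_eq_measure)
      then show ?thesis by (simp add: emM emN S)
    qed
    have un: "(\<Union>i. E i) \<inter> S = S"
      using E(3) sigma_sets_into_sp[OF space_closed S] by auto
    have inc: "incseq (\<lambda>i. E i \<inter> S)" using E(1) by (auto simp: incseq_def)
    have "emeasure M S = (SUP i. emeasure M (E i \<inter> S))"
      using SUP_emeasure_incseq[of "\<lambda>i. E i \<inter> S" M] inc by (simp add: un image_subset_iff)
    also have "\<dots> \<le> (SUP i. emeasure N (E i \<inter> S))" by (intro SUP_mono) (auto intro: part)
    also have "\<dots> = emeasure N S"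
      using SUP_emeasure_incseq[of "\<lambda>i. E i \<inter> S" N] inc by (simp add: un image_subset_iff)
    finally show ?thesis .
  qed
  then show ?thesis by (simp add: le_measure_iff sp M N le_fun_def)
qed

text \<open>
  A set of finite measure loses little when it is cut down to a large \<open>E i\<close>, where the measure is
  finite. The approximating set is also cut down to \<open>E i\<close>, so that its indicator function is square
  integrable.
\<close>

lemma algebra_approximates_finite_measure_set:
  assumes alg: "algebra \<Omega> \<C>" and M: "sets M = sigma_sets \<Omega> \<C>"
    and E: "incseq E" "\<And>i::nat. E i \<in> \<C>" "(\<Union>i. E i) = \<Omega>" "\<And>i. emeasure M (E i) \<noteq> \<infinity>"
    and S: "S \<in> sets M" "emeasure M S \<noteq> \<infinity>" and "e > 0"
  shows "\<exists>U\<in>\<C>. emeasure M U \<noteq> \<infinity> \<and> measure M (sym_diff S U) < e"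
proof -
  interpret algebra \<Omega> \<C> by fact
  have sp: "space M = \<Omega>"
    using sets_eq_imp_space_eq[of M "sigma \<Omega> \<C>"] M space_closed by auto
  have [measurable]: "S \<in> sets M" "E i \<in> sets M" for i using S E(2) by (auto simp: M)
  have "(\<lambda>i. measure M (S - E i)) \<longlonglongrightarrow> measure M (\<Inter>i. S - E i)"
  proof (rule Lim_measure_decseq)
    show "decseq (\<lambda>i. S - E i)" using E(1) by (auto simp: incseq_def decseq_def)
    show "emeasure M (S - E i) \<noteq> \<infinity>" for i
      using S emeasure_mono[of "S - E i" S M] by (auto simp: top_unique)
  qed auto
  also have "(\<Inter>i. S - E i) = {}" using E(3) sets.sets_into_space[OF S(1)] sp by auto
  finally have "\<forall>\<^sub>F i in sequentially. measure M (S - E i) < e / 2"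
    using \<open>e > 0\<close> by (intro order_tendstoD(2)[where y = 0]) auto
  then obtain i where i: "measure M (S - E i) < e / 2" by (auto simp: eventually_sequentially)
  define K where "K = density M (indicator (E i))"
  have "E i \<inter> \<Omega> = E i" using E(3) by auto
  then interpret K: finite_measure K
    using E(4)[of i] by (intro finite_measureI) (simp add: K_def emeasure_restricted sp[symmetric])
  obtain U where U: "U \<in> \<C>" "measure K (sym_diff S U) < e / 2"
    using algebra_approximates_sigma_algebra[OF alg, of "{K}" S "e / 2"] S K.finite_measure_axioms \<open>e > 0\<close>
    by (auto simp: K_def M)
  have [measurable]: "U \<in> sets M" using U by (auto simp: M)
  have m: "measure M (E i \<inter> sym_diff S U) < e / 2"
    using U(2) by (simp add: K_def measure_restricted)
  have fin: "emeasure M (E i \<inter> U) \<noteq> \<infinity>"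
    using E(4)[of i] emeasure_mono[of "E i \<inter> U" "E i" M] by (auto simp: top_unique)
  have f1: "S - E i \<in> fmeasurable M" "E i \<inter> sym_diff S U \<in> fmeasurable M"
    using S E(4)[of i] emeasure_mono[of "S - E i" S M] emeasure_mono[of "E i \<inter> sym_diff S U" "E i" M]
    by (auto simp: fmeasurable_def less_top)
  have "measure M (sym_diff S (E i \<inter> U)) \<le> measure M ((S - E i) \<union> (E i \<inter> sym_diff S U))"
    using f1 by (intro measure_mono_fmeasurable fmeasurable.Un) auto
  also have "\<dots> \<le> measure M (S - E i) + measure M (E i \<inter> sym_diff S U)"
    by (intro measure_Un_le) auto
  also have "\<dots> < e" using i m by simp
  finally show ?thesis using fin U(1) E(2) by (intro bexI[of _ "E i \<inter> U"]) auto
qed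

section \<open>Square integrable functions\<close>

lemma square_integrable_scale:
  "square_integrable M f \<Longrightarrow> square_integrable M (\<lambda>x. a * f x)"
  by (auto simp: square_integrable_def norm_mult power_mult_distrib)

lemma square_integrable_add:
  assumes "square_integrable M f" "square_integrable M g"
  shows "square_integrable M (\<lambda>x. f x + g x)"
  using square_integrable_diff[OF assms(1) square_integrable_scale[OF assms(2), of "- 1"]] by simp

lemma square_integrable_cong:
  "(\<And>x. x \<in> space M \<Longrightarrow> f x = g x) \<Longrightarrow> square_integrable M f \<longleftrightarrow> square_integrable M g"
  by (simp add: square_integrable_def cong: measurable_cong Bochner_Integration.integrable_cong)

lemma seminorm2_cong:
  "(\<And>x. x \<in> space M \<Longrightarrow> f x = g x) \<Longrightarrow> seminorm2 M f = seminorm2 M g"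
  by (simp add: seminorm2_def cong: Bochner_Integration.integral_cong)

lemma seminorm2_nonneg: "0 \<le> seminorm2 M f"
  by (simp add: seminorm2_def)

lemma seminorm2_scale: "seminorm2 M (\<lambda>x. a * f x) = cmod a * seminorm2 M f"
  by (simp add: seminorm2_def norm_mult power_mult_distrib real_sqrt_mult)

lemma seminorm2_commute: "seminorm2 M (\<lambda>x. f x - g x) = seminorm2 M (\<lambda>x. g x - f x)"
  by (simp add: seminorm2_def norm_minus_commute)

lemma seminorm2_add_le:
  assumes "square_integrable M f" "square_integrable M g"
  shows "seminorm2 M (\<lambda>x. f x + g x) \<le> seminorm2 M f + seminorm2 M g"
  by (rule seminorm2_triangle[OF assms norm_triangle_ineq square_integrable_add[OF assms]])

lemma seminorm2_diff_triangle:
  assumes "square_integrable M f" "square_integrable M g" "square_integrable M h"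
  shows "seminorm2 M (\<lambda>x. f x - h x) \<le> seminorm2 M (\<lambda>x. f x - g x) + seminorm2 M (\<lambda>x. g x - h x)"
  using seminorm2_add_le[OF square_integrable_diff[OF assms(1,2)] square_integrable_diff[OF assms(2,3)]]
  by simp

lemma square_integrable_indicator:
  "S \<in> sets M \<Longrightarrow> square_integrable M (indicator S) \<longleftrightarrow> emeasure M S < \<infinity>"
proof -
  assume S: "S \<in> sets M"
  have "(\<lambda>x. (cmod (indicator S x))\<^sup>2) = (indicator S :: _ \<Rightarrow> real)"
    by (auto simp: indicator_def)
  then show ?thesis using S sets.sets_into_space[OF S]
    by (simp add: square_integrable_def integrable_indicator_iff Int_absorb2)
qed

lemma seminorm2_indicator_diff:
  assumes "S \<in> sets M" "U \<in> sets M"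
  shows "seminorm2 M (\<lambda>x. indicator S x - indicator U x) = sqrt (measure M (sym_diff S U))"
proof -
  have "(\<lambda>x. (cmod (indicator S x - indicator U x))\<^sup>2) = (indicator (sym_diff S U) :: _ \<Rightarrow> real)"
    by (auto simp: indicator_def)
  moreover have "sym_diff S U \<inter> space M = sym_diff S U"
    using sets.sets_into_space[OF assms(1)] sets.sets_into_space[OF assms(2)] by auto
  ultimately show ?thesis by (simp add: seminorm2_def)
qed

lemma seminorm2_indicator:
  assumes "S \<in> sets M"
  shows "seminorm2 M (indicator S) = sqrt (measure M S)"
  using seminorm2_indicator_diff[OF assms sets.empty_sets] by simp

lemma seminorm2_nn_integral:
  assumes "square_integrable M f"
  shows "(\<integral>\<^sup>+x. ennreal ((cmod (f x))\<^sup>2) \<partial>M) = ennreal ((seminorm2 M f)\<^sup>2)"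
  using assms by (simp add: square_integrable_def seminorm2_def nn_integral_eq_integral)

text \<open>
  A measurable function is a pointwise limit of simple functions of at most twice its modulus. If it
  is square integrable, these are linear combinations of indicators of sets of finite measure, and
  dominated convergence makes the limit one in the seminorm. The last case is phrased with
  approximants instead of sequences because its uses are epsilon arguments.
\<close>

lemma square_integrable_induct [consumes 1, case_names indicator scale add approx]:
  assumes f: "square_integrable M f"
    and indicator: "\<And>S. S \<in> sets M \<Longrightarrow> emeasure M S \<noteq> \<infinity> \<Longrightarrow> P (indicator S)"
    and scale: "\<And>a f. square_integrable M f \<Longrightarrow> P f \<Longrightarrow> P (\<lambda>x. a * f x)"
    and add: "\<And>f g. square_integrable M f \<Longrightarrow> P f \<Longrightarrow> square_integrable M g \<Longrightarrow> P g \<Longrightarrow>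
      P (\<lambda>x. f x + g x)"
    and approx: "\<And>f. square_integrable M f \<Longrightarrow>
      (\<And>e. e > 0 \<Longrightarrow> \<exists>g. square_integrable M g \<and> P g \<and> seminorm2 M (\<lambda>x. f x - g x) < e) \<Longrightarrow> P f"
  shows "P f"
proof (rule approx[OF f])
  fix e :: real assume "e > 0"
  have [measurable]: "f \<in> borel_measurable M" and f2: "integrable M (\<lambda>x. (cmod (f x))\<^sup>2)"
    using f by (auto simp: square_integrable_def)
  obtain s where "(\<forall>i. simple_function M (s i)) \<and> (\<forall>x\<in>space M. (\<lambda>i. s i x) \<longlonglongrightarrow> f x) \<and>
      (\<forall>i. \<forall>x\<in>space M. dist (s i x) 0 \<le> 2 * dist (f x) 0)"
    using borel_measurable_implies_sequence_metric[OF \<open>f \<in> borel_measurable M\<close>, of 0] by (rule exE)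
  then have s: "\<And>i. simple_function M (s i)"
    and lim: "\<And>x. x \<in> space M \<Longrightarrow> (\<lambda>i. s i x) \<longlonglongrightarrow> f x"
    and bound: "\<And>i x. x \<in> space M \<Longrightarrow> cmod (s i x) \<le> 2 * cmod (f x)"
    by (simp_all add: dist_norm)
  have [measurable]: "s i \<in> borel_measurable M" for i
    using s by (rule borel_measurable_simple_function)
  have s2: "square_integrable M (s i)" for i
    unfolding square_integrable_def
  proof
    show "integrable M (\<lambda>x. (cmod (s i x))\<^sup>2)"
    proof (rule Bochner_Integration.integrable_bound)
      show "integrable M (\<lambda>x. 4 * (cmod (f x))\<^sup>2)" using f2 by simp
      show "AE x in M. norm ((cmod (s i x))\<^sup>2) \<le> norm (4 * (cmod (f x))\<^sup>2)"
        using power_mono[OF bound, of _ i 2] by (intro AE_I2) (simp add: power_mult_distrib)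
    qed measurable
  qed measurable
  have "(\<lambda>i. \<integral>x. (cmod (f x - s i x))\<^sup>2 \<partial>M) \<longlonglongrightarrow> (\<integral>x. 0 \<partial>M)"
  proof (rule integral_dominated_convergence)
    \<comment> \<open>the factor is 3 squared: \<open>cmod (f x - s i x) \<le> cmod (f x) + 2 * cmod (f x)\<close>\<close>
    show "integrable M (\<lambda>x. 9 * (cmod (f x))\<^sup>2)" using f2 by simp
    show "AE x in M. (\<lambda>i. (cmod (f x - s i x))\<^sup>2) \<longlonglongrightarrow> 0"
    proof (rule AE_I2)
      fix x assume "x \<in> space M"
      then have "(\<lambda>i. (cmod (f x - s i x))\<^sup>2) \<longlonglongrightarrow> (cmod (f x - f x))\<^sup>2"
        by (intro tendsto_intros lim)
      then show "(\<lambda>i. (cmod (f x - s i x))\<^sup>2) \<longlonglongrightarrow> 0" by simp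
    qed
    show "AE x in M. norm ((cmod (f x - s i x))\<^sup>2) \<le> 9 * (cmod (f x))\<^sup>2" for i
    proof (rule AE_I2)
      fix x assume "x \<in> space M"
      then have "cmod (f x - s i x) \<le> 3 * cmod (f x)"
        using bound[of x i] norm_triangle_ineq4[of "f x" "s i x"] by simp
      from power_mono[OF this, of 2] show "norm ((cmod (f x - s i x))\<^sup>2) \<le> 9 * (cmod (f x))\<^sup>2"
        by (simp add: power_mult_distrib)
    qed
  qed measurable
  then have "(\<lambda>i. seminorm2 M (\<lambda>x. f x - s i x)) \<longlonglongrightarrow> 0"
    unfolding seminorm2_def using tendsto_real_sqrt by fastforce
  then have "\<forall>\<^sub>F i in sequentially. seminorm2 M (\<lambda>x. f x - s i x) < e"
    using \<open>e > 0\<close> by (auto intro: order_tendstoD)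
  then obtain i where i: "seminorm2 M (\<lambda>x. f x - s i x) < e"
    by (auto simp: eventually_sequentially)
  \<comment> \<open>the value 0 is left out of the sum below, since its level set may have infinite measure\<close>
  define T where "T y = s i -` {y} \<inter> space M" for y
  have T: "T y \<in> sets M" for y unfolding T_def by measurable
  have fin: "emeasure M (T y) \<noteq> \<infinity>" if "y \<noteq> 0" for y
  proof -
    have "integrable M (\<lambda>x. 1 / (cmod y)\<^sup>2 * (cmod (s i x))\<^sup>2)"
      using s2[of i] by (auto simp: square_integrable_def)
    then have "integrable M (indicator (T y) :: _ \<Rightarrow> real)"
      by (rule Bochner_Integration.integrable_bound)
        (use T that in \<open>auto simp: T_def indicator_def\<close>)
    then show ?thesis using T[of y] by (simp add: integrable_indicator_iff T_def)
  qed
  have sums: "square_integrable M (\<lambda>x. \<Sum>y\<in>I. y * indicator (T y) x) \<and> P (\<lambda>x. \<Sum>y\<in>I. y * indicator (T y) x)"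
    if "finite I" "0 \<notin> I" for I
    using that
  proof (induction I)
    case empty
    have "P (indicator {})" by (rule indicator) auto
    moreover have "(indicator {} :: 'a \<Rightarrow> complex) = (\<lambda>x. 0)" by auto
    ultimately show ?case by (simp add: square_integrable_def)
  next
    case (insert y I)
    have T_y: "square_integrable M (indicator (T y))" "P (indicator (T y))"
      using fin[of y] T insert.prems
      by (auto intro!: indicator simp: square_integrable_indicator less_top)
    have ind: "square_integrable M (\<lambda>x. y * indicator (T y) x)" "P (\<lambda>x. y * indicator (T y) x)"
      by (rule square_integrable_scale[OF T_y(1)], rule scale[OF T_y])
    have "0 \<notin> I" using insert.prems by simp
    note sum = conjunct1[OF insert.IH[OF this]] conjunct2[OF insert.IH[OF this]]
    show ?case
      unfolding sum.insert[OF insert.hyps]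
      by (rule conjI[OF square_integrable_add[OF ind(1) sum(1)] add[OF ind sum]])
  qed
  have "finite (s i ` space M - {0})" using s[of i] by (simp add: simple_function_def)
  note g = sums[OF this]
  have "(\<Sum>y\<in>s i ` space M - {0}. y * indicator (T y) x) = s i x" if "x \<in> space M" for x
  proof -
    have "(\<Sum>y\<in>s i ` space M - {0}. y * indicator (T y) x)
        = (\<Sum>y\<in>s i ` space M - {0}. if y = s i x then s i x else 0)"
      using that by (intro sum.cong) (auto simp: T_def indicator_def)
    then show ?thesis using that s[of i] by (simp add: simple_function_def)
  qed
  then have "seminorm2 M (\<lambda>x. f x - (\<Sum>y\<in>s i ` space M - {0}. y * indicator (T y) x)) < e"
    using i by (subst seminorm2_cong[where g = "\<lambda>x. f x - s i x"]) auto
  with g show "\<exists>g. square_integrable M g \<and> P g \<and> seminorm2 M (\<lambda>x. f x - g x) < e"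
    by (intro exI[of _ "\<lambda>x. \<Sum>y\<in>s i ` space M - {0}. y * indicator (T y) x"]) simp
qed

text \<open>
  Domination of the image measure by a multiple of \<open>M\<close> is the form in which boundedness of the density
  is used throughout: by the change of variables formula, \<open>f \<mapsto> f \<circ> \<phi>\<close> is then bounded by \<open>sqrt c\<close>.
\<close>

lemma
  assumes \<phi>[measurable]: "\<phi> \<in> N \<rightarrow>\<^sub>M M" and le: "distr N M \<phi> \<le> scale_measure (ennreal c) M" and "0 \<le> c"
    and f: "square_integrable M f"
  shows square_integrable_comp: "square_integrable N (\<lambda>x. f (\<phi> x))"
    and seminorm2_comp_le: "seminorm2 N (\<lambda>x. f (\<phi> x)) \<le> sqrt c * seminorm2 M f"
proof -
  have [measurable]: "f \<in> borel_measurable M" using f by (simp add: square_integrable_def)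
  have "(\<integral>\<^sup>+x. ennreal ((cmod (f (\<phi> x)))\<^sup>2) \<partial>N) = (\<integral>\<^sup>+x. ennreal ((cmod (f x))\<^sup>2) \<partial>distr N M \<phi>)"
    by (simp add: nn_integral_distr)
  also have "\<dots> \<le> (\<integral>\<^sup>+x. ennreal ((cmod (f x))\<^sup>2) \<partial>scale_measure (ennreal c) M)"
    using le by (intro nn_integral_mono_measure) auto
  also have "\<dots> = ennreal (c * (seminorm2 M f)\<^sup>2)"
    using f \<open>0 \<le> c\<close> by (simp add: nn_integral_scale_measure seminorm2_nn_integral ennreal_mult)
  finally have *: "(\<integral>\<^sup>+x. ennreal ((cmod (f (\<phi> x)))\<^sup>2) \<partial>N) \<le> ennreal (c * (seminorm2 M f)\<^sup>2)" .
  have "integrable N (\<lambda>x. (cmod (f (\<phi> x)))\<^sup>2)"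
    using le_less_trans[OF *] by (intro integrableI_bounded) auto
  then show 1: "square_integrable N (\<lambda>x. f (\<phi> x))" by (simp add: square_integrable_def)
  have "(seminorm2 N (\<lambda>x. f (\<phi> x)))\<^sup>2 \<le> c * (seminorm2 M f)\<^sup>2"
    using * seminorm2_nn_integral[OF 1] \<open>0 \<le> c\<close> by simp
  then have "seminorm2 N (\<lambda>x. f (\<phi> x)) \<le> sqrt (c * (seminorm2 M f)\<^sup>2)"
    by (rule real_le_rsqrt)
  then show "seminorm2 N (\<lambda>x. f (\<phi> x)) \<le> sqrt c * seminorm2 M f"
    by (simp add: real_sqrt_mult seminorm2_nonneg)
qed

text \<open>
  Strong convergence of composition operators. For an indicator function the hypothesis on the
  preimages is the claim itself, up to a square root. Since all operators involved are bounded by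
  the same \<open>sqrt c\<close>, the functions for which convergence holds form a closed subspace.
\<close>

lemma comp_tendsto_if_preimages_tendsto:
  fixes \<phi> :: "nat \<Rightarrow> 'b \<Rightarrow> 'a"
  assumes \<phi>n: "\<And>n. \<phi> n \<in> N \<rightarrow>\<^sub>M M" "\<And>n. distr N M (\<phi> n) \<le> scale_measure (ennreal c) M"
    and \<psi>: "\<psi> \<in> N \<rightarrow>\<^sub>M M" "distr N M \<psi> \<le> scale_measure (ennreal c) M" and c: "0 \<le> c"
    and lim: "\<And>S. S \<in> sets M \<Longrightarrow> emeasure M S \<noteq> \<infinity> \<Longrightarrow>
      (\<lambda>n. measure N (sym_diff (\<phi> n -` S \<inter> space N) (\<psi> -` S \<inter> space N))) \<longlonglongrightarrow> 0"
    and f: "square_integrable M f"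
  shows "(\<lambda>n. seminorm2 N (\<lambda>x. f (\<phi> n x) - f (\<psi> x))) \<longlonglongrightarrow> 0"
  using f
proof (induction rule: square_integrable_induct)
  case (indicator S)
  have [measurable]: "\<phi> n \<in> N \<rightarrow>\<^sub>M M" "\<psi> \<in> N \<rightarrow>\<^sub>M M" "S \<in> sets M" for n
    using \<phi>n \<psi> indicator by auto
  have "seminorm2 N (\<lambda>x. indicator S (\<phi> n x) - indicator S (\<psi> x))
      = sqrt (measure N (sym_diff (\<phi> n -` S \<inter> space N) (\<psi> -` S \<inter> space N)))" for n
  proof (subst seminorm2_indicator_diff[symmetric])
    show "seminorm2 N (\<lambda>x. indicator S (\<phi> n x) - indicator S (\<psi> x)) =
      seminorm2 N (\<lambda>x. indicator (\<phi> n -` S \<inter> space N) x - indicator (\<psi> -` S \<inter> space N) x)"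
      by (rule seminorm2_cong) (simp add: indicator_def)
  qed measurable
  then show ?case using tendsto_real_sqrt[OF lim[OF indicator]] by simp
next
  case (scale a f)
  have "seminorm2 N (\<lambda>x. a * f (\<phi> n x) - a * f (\<psi> x)) = cmod a * seminorm2 N (\<lambda>x. f (\<phi> n x) - f (\<psi> x))" for n
    by (simp add: seminorm2_scale[symmetric] right_diff_distrib)
  then show ?case using tendsto_mult_right_zero[OF scale.IH] by simp
next
  case (add f g)
  note comp = square_integrable_comp[OF \<phi>n c] square_integrable_comp[OF \<psi> c]
  have le: "seminorm2 N (\<lambda>x. f (\<phi> n x) + g (\<phi> n x) - (f (\<psi> x) + g (\<psi> x)))
      \<le> seminorm2 N (\<lambda>x. f (\<phi> n x) - f (\<psi> x)) + seminorm2 N (\<lambda>x. g (\<phi> n x) - g (\<psi> x))" for n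
    using seminorm2_add_le[OF square_integrable_diff[OF comp[OF add(1)]] square_integrable_diff[OF comp[OF add(2)]], of n n]
    by (simp add: algebra_simps)
  have "(\<lambda>n. seminorm2 N (\<lambda>x. f (\<phi> n x) - f (\<psi> x)) + seminorm2 N (\<lambda>x. g (\<phi> n x) - g (\<psi> x))) \<longlonglongrightarrow> 0"
    using tendsto_add[OF add.IH] by simp
  then show ?case
    by (rule Lim_null_comparison[rotated]) (simp add: le seminorm2_nonneg)
next
  case (approx f)
  note comp = square_integrable_comp[OF \<phi>n c] square_integrable_comp[OF \<psi> c]
  show ?case
  proof (rule LIMSEQ_I)
    fix r :: real assume "r > 0"
    \<comment> \<open>one is added to \<open>sqrt c\<close> because \<open>c\<close> may be 0\<close>
    define q where "q = sqrt c + 1"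
    define e where "e = r / (2 * q)"
    have "q > 0" using c by (simp add: q_def add_nonneg_pos)
    then have "e > 0" using \<open>r > 0\<close> by (simp add: e_def)
    then obtain g where g: "square_integrable M g" "seminorm2 M (\<lambda>x. f x - g x) < e / 2"
        "(\<lambda>n. seminorm2 N (\<lambda>x. g (\<phi> n x) - g (\<psi> x))) \<longlonglongrightarrow> 0"
      using approx.IH[of "e / 2"] by auto
    have fg: "square_integrable M (\<lambda>x. f x - g x)"
      by (rule square_integrable_diff[OF approx.hyps g(1)])
    have small: "sqrt c * seminorm2 M (\<lambda>x. f x - g x) \<le> sqrt c * (e / 2)"
      using g(2) c by (intro mult_left_mono) auto
    have bound: "seminorm2 N (\<lambda>x. f (\<phi> n x) - f (\<psi> x)) \<le> sqrt c * e + seminorm2 N (\<lambda>x. g (\<phi> n x) - g (\<psi> x))" for n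
    proof -
      note s = comp[OF approx.hyps] comp[OF g(1)]
      have "seminorm2 N (\<lambda>x. f (\<phi> n x) - f (\<psi> x))
          \<le> seminorm2 N (\<lambda>x. f (\<phi> n x) - g (\<phi> n x))
            + (seminorm2 N (\<lambda>x. g (\<phi> n x) - g (\<psi> x)) + seminorm2 N (\<lambda>x. g (\<psi> x) - f (\<psi> x)))"
        by (intro order_trans[OF seminorm2_diff_triangle[OF s(1) s(3)[of n] s(2)]]
          add_left_mono seminorm2_diff_triangle s)
      moreover have "seminorm2 N (\<lambda>x. f (\<phi> n x) - g (\<phi> n x)) \<le> sqrt c * (e / 2)"
        using seminorm2_comp_le[OF \<phi>n c fg] small by (rule order_trans)
      moreover have "seminorm2 N (\<lambda>x. f (\<psi> x) - g (\<psi> x)) \<le> sqrt c * (e / 2)"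
        using seminorm2_comp_le[OF \<psi> c fg] small by (rule order_trans)
      ultimately show ?thesis by (simp add: seminorm2_commute[of N "\<lambda>x. g (\<psi> x)"])
    qed
    have "\<forall>\<^sub>F n in sequentially. seminorm2 N (\<lambda>x. g (\<phi> n x) - g (\<psi> x)) < e"
      using g(3) \<open>e > 0\<close> by (auto intro: order_tendstoD)
    then obtain n0 where n0: "\<And>n. n \<ge> n0 \<Longrightarrow> seminorm2 N (\<lambda>x. g (\<phi> n x) - g (\<psi> x)) < e"
      by (auto simp: eventually_sequentially)
    have "sqrt c * e + e = q * e" by (simp add: q_def distrib_right)
    also have "\<dots> = r / 2" using \<open>q > 0\<close> by (simp add: e_def)
    finally have "sqrt c * e + e = r / 2" .
    then have "norm (seminorm2 N (\<lambda>x. f (\<phi> n x) - f (\<psi> x)) - 0) < r" if "n \<ge> n0" for n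
      using bound[of n] n0[OF that] \<open>r > 0\<close> by (simp add: seminorm2_nonneg)
    then show "\<exists>n0. \<forall>n\<ge>n0. norm (seminorm2 N (\<lambda>x. f (\<phi> n x) - f (\<psi> x)) - 0) < r" by blast
  qed
qed

section \<open>Equivalence classes and composition operators\<close>

lemma seminorm2_cong_AE:
  assumes "square_integrable M f" "square_integrable M g" "AE x in M. f x = g x"
  shows "seminorm2 M f = seminorm2 M g"
proof -
  have [measurable]: "f \<in> borel_measurable M" "g \<in> borel_measurable M"
    using assms by (auto simp: square_integrable_def)
  have "(\<integral>x. (cmod (f x))\<^sup>2 \<partial>M) = (\<integral>x. (cmod (g x))\<^sup>2 \<partial>M)"
    using assms(3) by (intro integral_cong_AE) auto
  then show ?thesis by (simp add: seminorm2_def)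
qed

lemma ae_class_in_L2: "square_integrable M f \<Longrightarrow> ae_class M f \<in> L2 M"
  by (auto simp: L2_def)

lemma
  assumes "square_integrable M f"
  shows square_integrable_rep_ae_class: "square_integrable M (rep (ae_class M f))"
    and AE_rep_ae_class: "AE x in M. rep (ae_class M f) x = f x"
  using rep_L2(1)[OF ae_class_in_L2[OF assms]] by (auto simp: ae_class_def)

lemma L2_norm_ae_class: "square_integrable M f \<Longrightarrow> L2_norm M (ae_class M f) = seminorm2 M f"
  unfolding L2_norm_def
  by (intro seminorm2_cong_AE square_integrable_rep_ae_class AE_rep_ae_class)

lemma L2_dist_ae_class:
  assumes f: "square_integrable M f" and g: "square_integrable M g"
  shows "L2_dist M (ae_class M f) (ae_class M g) = seminorm2 M (\<lambda>x. f x - g x)"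
  unfolding L2_dist_def
proof (rule seminorm2_cong_AE)
  show "AE x in M. rep (ae_class M f) x - rep (ae_class M g) x = f x - g x"
    using AE_rep_ae_class[OF f] AE_rep_ae_class[OF g] by eventually_elim simp
qed (intro square_integrable_diff square_integrable_rep_ae_class f g)+

lemma L2_cases:
  assumes "F \<in> L2 M"
  obtains f where "square_integrable M f" "F = ae_class M f"
  using assms by (auto simp: L2_def)

lemma topspace_L2_topology: "topspace (L2_topology M) = L2 M"
  unfolding L2_topology_def by (rule Metric_space.topspace_mtopology[OF Metric_space_L2])

lemma Hausdorff_space_L2_topology: "Hausdorff_space (L2_topology M)"
  unfolding L2_topology_def by (rule Metric_space.Hausdorff_space_mtopology[OF Metric_space_L2])

lemma limitin_L2_topology_ae_class:
  assumes g: "square_integrable M g" and f: "\<And>n. n \<ge> k \<Longrightarrow> square_integrable M (f n)"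
    and F: "\<And>n. n \<ge> k \<Longrightarrow> F n = ae_class M (f n)"
    and lim: "(\<lambda>n. seminorm2 M (\<lambda>x. f n x - g x)) \<longlonglongrightarrow> 0"
  shows "limitin (L2_topology M) F (ae_class M g) sequentially"
proof -
  have "\<forall>\<^sub>F n in sequentially. F n \<in> L2 M"
    using f F by (auto simp: eventually_sequentially intro!: exI[of _ k] ae_class_in_L2)
  moreover have "\<forall>\<^sub>F n in sequentially. seminorm2 M (\<lambda>x. f n x - g x) = L2_dist M (F n) (ae_class M g)"
    using f F g by (auto simp: eventually_sequentially L2_dist_ae_class intro!: exI[of _ k])
  ultimately show ?thesis
    unfolding L2_topology_def
    using Lim_transform_eventually[OF lim] ae_class_in_L2[OF g]
    by (simp add: Metric_space.limitin_metric_dist_null[OF Metric_space_L2])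
qed

lemma distr_le_scale_measureI:
  assumes "\<And>S. S \<in> sets M \<Longrightarrow> emeasure (distr N M \<phi>) S \<le> c * emeasure M S"
  shows "distr N M \<phi> \<le> scale_measure c M"
proof -
  have "emeasure (distr N M \<phi>) S \<le> c * emeasure M S" for S
    using assms by (cases "S \<in> sets M") (auto simp: emeasure_notin_sets)
  then show ?thesis by (simp add: le_measure_iff le_fun_def space_scale_measure)
qed

lemma absolutely_continuous_if_dominated:
  assumes "distr N M \<phi> \<le> scale_measure c M"
  shows "absolutely_continuous M (distr N M \<phi>)"
proof -
  have "emeasure (distr N M \<phi>) S \<le> c * emeasure M S" for S
    using le_measureD3[OF assms, of S] by simp
  then show ?thesis
    by (auto simp: absolutely_continuous_def null_sets_def) (metis le_zero_eq mult_zero_right)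
qed

lemma comp_op_dominated:
  assumes \<phi>: "\<phi> \<in> N \<rightarrow>\<^sub>M M" and le: "distr N M \<phi> \<le> scale_measure (ennreal c) M" and "0 \<le> c"
    and f: "square_integrable M f"
  shows "comp_op M N \<phi> (ae_class M f) = Some (ae_class N (\<lambda>x. f (\<phi> x)))"
  using comp_op_eq[OF \<phi> absolutely_continuous_if_dominated[OF le] f] square_integrable_comp[OF assms]
  by (simp add: o_def)

lemma dom_comp_op_dominated:
  assumes \<phi>: "\<phi> \<in> N \<rightarrow>\<^sub>M M" and le: "distr N M \<phi> \<le> scale_measure (ennreal c) M" and "0 \<le> c"
  shows "dom (comp_op M N \<phi>) = L2 M"
proof
  show "dom (comp_op M N \<phi>) \<subseteq> L2 M" by (auto simp: comp_op_def split: if_splits)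
  show "L2 M \<subseteq> dom (comp_op M N \<phi>)"
    by (auto simp: comp_op_dominated[OF assms] elim!: L2_cases)
qed

lemma bounded_on_L2_comp_op:
  assumes \<phi>: "\<phi> \<in> M \<rightarrow>\<^sub>M M" and le: "distr M M \<phi> \<le> scale_measure (ennreal c) M" and c: "0 \<le> c"
  shows "bounded_on_L2 M (comp_op M M \<phi>)"
  unfolding bounded_on_L2_def
proof (intro conjI exI ballI)
  note comp = square_integrable_comp[OF assms]
  show "dom (comp_op M M \<phi>) = L2 M" by (rule dom_comp_op_dominated[OF assms])
  show "ran (comp_op M M \<phi>) \<subseteq> L2 M"
    by (auto simp: ran_def comp_op_def ae_class_in_L2 split: if_splits)
  show "L2_norm M (the (comp_op M M \<phi> F)) \<le> sqrt c * L2_norm M F" if "F \<in> L2 M" for F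
    using that seminorm2_comp_le[OF assms]
    by (elim L2_cases) (simp add: comp_op_dominated[OF assms] L2_norm_ae_class comp)
qed

lemma continuous_map_comp_op:
  assumes \<phi>: "\<phi> \<in> N \<rightarrow>\<^sub>M M" and le: "distr N M \<phi> \<le> scale_measure (ennreal c) M" and c: "0 \<le> c"
  shows "continuous_map (L2_topology M) (L2_topology N) (\<lambda>F. the (comp_op M N \<phi> F))"
  unfolding L2_topology_def Metric_space.metric_continuous_map[OF Metric_space_L2 Metric_space_L2]
proof (intro conjI ballI allI impI)
  note comp = square_integrable_comp[OF assms]
  show "(\<lambda>F. the (comp_op M N \<phi> F)) ` L2 M \<subseteq> L2 N"
    by (auto elim!: L2_cases simp: comp_op_dominated[OF assms] ae_class_in_L2 comp)
  fix F and e :: real assume F: "F \<in> L2 M" and "e > 0"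
  have c1: "sqrt c + 1 > 0" using c by (simp add: add_nonneg_pos)
  have "L2_dist N (the (comp_op M N \<phi> F)) (the (comp_op M N \<phi> G)) < e"
    if G: "G \<in> L2 M" and d: "L2_dist M F G < e / (sqrt c + 1)" for G
  proof -
    obtain f where f: "square_integrable M f" "F = ae_class M f" using F by (rule L2_cases)
    obtain g where g: "square_integrable M g" "G = ae_class M g" using G by (rule L2_cases)
    have "L2_dist N (the (comp_op M N \<phi> F)) (the (comp_op M N \<phi> G)) \<le> sqrt c * L2_dist M F G"
      using seminorm2_comp_le[OF assms square_integrable_diff[OF f(1) g(1)]] f g
      by (simp add: comp_op_dominated[OF assms] L2_dist_ae_class comp)
    also have "\<dots> \<le> (sqrt c + 1) * L2_dist M F G"
      by (intro mult_right_mono) (auto simp: L2_dist_def seminorm2_nonneg)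
    also have "\<dots> < e" using d c1 by (simp add: field_simps)
    finally show ?thesis .
  qed
  then show "\<exists>d>0. \<forall>G. G \<in> L2 M \<and> L2_dist M F G < d \<longrightarrow>
      L2_dist N (the (comp_op M N \<phi> F)) (the (comp_op M N \<phi> G)) < e"
    using \<open>e > 0\<close> c1 by (intro exI[of _ "e / (sqrt c + 1)"]) auto
qed

text \<open>
  The graph of a continuous map into a Hausdorff space is closed, so the closure of the graph of the
  restriction stays inside the graph of \<open>T\<close>. Conversely \<open>F \<mapsto> (F, T F)\<close> is continuous and hence maps
  the closure of \<open>D\<close>, which is everything, into the closure of the graph over \<open>D\<close>.
\<close>

lemma is_operator_closure_restrict_dense:
  assumes dom: "dom T = L2 M"
    and cont: "continuous_map (L2_topology M) (L2_topology M) (\<lambda>F. the (T F))"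
    and D: "D \<subseteq> L2 M" "L2_topology M closure_of D = L2 M"
  shows "is_operator_closure M T (T |` D)"
proof -
  define g where "g F = (F, the (T F))" for F
  have some: "\<exists>H. T F = Some H" if "F \<in> L2 M" for F
    using that dom by blast
  have graph_restrict: "Map.graph (T |` S) = g ` S" if "S \<subseteq> L2 M" for S
  proof -
    have "(T |` S) F = Some H \<longleftrightarrow> F \<in> S \<and> H = the (T F)" for F H
      using some[of F] that by (cases "F \<in> S") auto
    then show ?thesis by (auto simp: Map.graph_def g_def)
  qed
  have "T |` L2 M = T"
    unfolding dom[symmetric] by (rule ext) (simp add: restrict_map_def domIff)
  then have graph: "Map.graph T = g ` L2 M" "Map.graph (T |` D) = g ` D"
    using graph_restrict[of "L2 M"] graph_restrict[of D] D(1) by simp_all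
  let ?P = "prod_topology (L2_topology M) (L2_topology M)"
  have "closedin ?P (g ` L2 M)"
    using continuous_map_imp_closed_graph[OF cont Hausdorff_space_L2_topology]
    by (simp add: topspace_L2_topology g_def[abs_def])
  then have "?P closure_of (g ` D) \<subseteq> g ` L2 M"
    by (intro closure_of_minimal image_mono D)
  moreover have "continuous_map (L2_topology M) ?P g"
    using cont by (simp add: g_def[abs_def] continuous_map_paired)
  then have "g ` L2 M \<subseteq> ?P closure_of (g ` D)"
    using continuous_map_image_closure_subset[of "L2_topology M" ?P g D] D by simp
  ultimately show ?thesis
    by (simp add: is_operator_closure_def closure_graph_def graph)
qed

lemma distr_le_if_RN_density_bounded:
  assumes "sigma_finite_measure M" and T: "T \<in> M \<rightarrow>\<^sub>M M" and "nonsingular M T"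
    and le: "esssup M (RN_density M T) \<le> c"
  shows "distr M M T \<le> scale_measure c M"
proof -
  interpret sigma_finite_measure M by fact
  have dens: "density M (RN_density M T) = distr M M T"
    unfolding RN_density_def by (rule density_RN_deriv) (use assms in \<open>auto simp: nonsingular_def\<close>)
  have [measurable]: "RN_density M T \<in> borel_measurable M" by (simp add: RN_density_def)
  have bound: "AE x in M. RN_density M T x \<le> c"
    using esssup_AE[of "RN_density M T" M] by eventually_elim (rule order_trans[OF _ le])
  have "emeasure (distr M M T) S \<le> c * emeasure M S" if "S \<in> sets M" for S
  proof -
    have "emeasure (distr M M T) S = (\<integral>\<^sup>+x. RN_density M T x * indicator S x \<partial>M)"
      using that by (simp add: dens[symmetric] emeasure_density)
    also have "\<dots> \<le> (\<integral>\<^sup>+x. c * indicator S x \<partial>M)"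
      using bound by (intro nn_integral_mono_AE) (auto intro!: mult_right_mono)
    finally show ?thesis using that by (simp add: nn_integral_cmult)
  qed
  then show ?thesis by (rule distr_le_scale_measureI)
qed

section \<open>Cylinder sets and functions of an isometric target space\<close>

context isometric_target_space
begin

text \<open>
  Applied to indicator functions, the isometry of \<open>\<Delta>\<close> says that \<open>\<epsilon> k\<close> preserves the measure of sets of
  finite measure; \<open>\<sigma>\<close>-finiteness extends this to all sets.
\<close>

lemma distr_\<epsilon>: "distr Y (X k) (\<epsilon> k) = X k"
proof (rule measure_eqI)
  note [measurable] = \<epsilon>_measurable
  interpret sigma_finite_measure "X k" by (rule sigma_finite)
  have finite_case: "emeasure Y (\<epsilon> k -` S \<inter> space Y) = emeasure (X k) S"
    if S[measurable]: "S \<in> sets (X k)" and fin: "emeasure (X k) S < \<infinity>" for S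
  proof -
    let ?C = "comp_op (X k) Y (\<epsilon> k)" and ?F = "ae_class (X k) (indicator S)"
    have ind: "square_integrable (X k) (indicator S)" using that by (simp add: square_integrable_indicator)
    have F: "?F \<in> L2 (X k)" using ind by (rule ae_class_in_L2)
    then have "?F \<in> dom ?C" and norm: "L2_norm Y (the (?C ?F)) = L2_norm (X k) ?F"
      using \<Delta>_isometry[of k] by (auto simp: isometry_L2_def)
    then have sq: "square_integrable Y (indicator S \<circ> \<epsilon> k)"
        and C: "?C ?F = Some (ae_class Y (indicator S \<circ> \<epsilon> k))"
      using comp_op_eq[OF \<epsilon>_measurable abs_cont ind] by (auto split: if_splits)
    let ?S' = "\<epsilon> k -` S \<inter> space Y"
    have eq: "(indicator S \<circ> \<epsilon> k) y = (indicator ?S' y :: complex)" if "y \<in> space Y" for y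
      using that by (simp add: indicator_def)
    have "square_integrable Y (indicator ?S')"
      using sq square_integrable_cong[of Y, OF eq] by simp
    then have fin': "emeasure Y ?S' < \<infinity>" by (simp add: square_integrable_indicator)
    have "seminorm2 Y (indicator ?S') = seminorm2 (X k) (indicator S)"
      using norm C seminorm2_cong[of Y, OF eq] by (simp add: L2_norm_ae_class sq ind)
    then have "measure Y ?S' = measure (X k) S" by (simp add: seminorm2_indicator)
    then show ?thesis using fin fin' by (simp add: emeasure_eq_ennreal_measure less_top)
  qed
  fix S assume "S \<in> sets (distr Y (X k) (\<epsilon> k))"
  then have S[measurable]: "S \<in> sets (X k)" by simp
  obtain F :: "nat \<Rightarrow> 'a set" where F: "range F \<subseteq> sets (X k)" "(\<Union>i. F i) = space (X k)"
      "\<And>i. emeasure (X k) (F i) \<noteq> \<infinity>" "incseq F"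
    by (rule sigma_finite_incseq) blast
  have [measurable]: "F i \<in> sets (X k)" for i using F(1) by auto
  have "emeasure (distr Y (X k) (\<epsilon> k)) (F i \<inter> S) = emeasure (X k) (F i \<inter> S)" for i
  proof -
    have "emeasure (X k) (F i \<inter> S) \<le> emeasure (X k) (F i)" by (rule emeasure_mono) auto
    also have "\<dots> < \<infinity>" using F(3)[of i] by (simp add: less_top)
    finally have "emeasure (X k) (F i \<inter> S) < \<infinity>" .
    then show ?thesis using finite_case[of "F i \<inter> S"] by (simp add: emeasure_distr del: vimage_Int)
  qed
  moreover have "incseq (\<lambda>i. F i \<inter> S)" using F(4) by (auto simp: incseq_def)
  moreover have "(\<Union>i. F i) \<inter> S = S" using F(2) sets.sets_into_space[OF S] by auto
  ultimately show "emeasure (distr Y (X k) (\<epsilon> k)) S = emeasure (X k) S"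
    using SUP_emeasure_incseq[of "\<lambda>i. F i \<inter> S" "X k"]
      SUP_emeasure_incseq[of "\<lambda>i. F i \<inter> S" "distr Y (X k) (\<epsilon> k)"]
    by (simp add: image_subset_iff)
qed simp

lemma distr_\<delta>:
  assumes "k \<le> m"
  shows "distr (X m) (X k) (\<delta> k m) = X k"
proof -
  have "distr (X m) (X k) (\<delta> k m) = distr Y (X k) (\<delta> k m \<circ> \<epsilon> m)"
    using distr_distr[OF \<delta>_measurable[OF assms] \<epsilon>_measurable] by (simp add: distr_\<epsilon>)
  also have "\<dots> = distr Y (X k) (\<epsilon> k)"
    using \<epsilon>_comp[OF assms] by (intro distr_cong) auto
  finally show ?thesis by (simp add: distr_\<epsilon>)
qed

definition cylinders :: "'b set set" where
  "cylinders = {\<epsilon> n -` \<sigma> \<inter> space Y | n \<sigma>. \<sigma> \<in> sets (X n)}"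

lemma cylinder_at_later_level:
  assumes "U \<in> cylinders"
  obtains n where "\<And>m. m \<ge> n \<Longrightarrow> \<exists>\<sigma>\<in>sets (X m). U = \<epsilon> m -` \<sigma> \<inter> space Y"
proof -
  obtain n \<sigma> where \<sigma>: "\<sigma> \<in> sets (X n)" "U = \<epsilon> n -` \<sigma> \<inter> space Y"
    using assms by (auto simp: cylinders_def)
  show ?thesis
  proof (rule that[of n], rule bexI)
    fix m assume "m \<ge> n"
    show "U = \<epsilon> m -` (\<delta> n m -` \<sigma> \<inter> space (X m)) \<inter> space Y"
      using \<epsilon>_comp[OF \<open>m \<ge> n\<close>] measurable_space[OF \<epsilon>_measurable] \<sigma>(2) by auto
    show "\<delta> n m -` \<sigma> \<inter> space (X m) \<in> sets (X m)"
      using \<delta>_measurable[OF \<open>m \<ge> n\<close>] \<sigma>(1) by (rule measurable_sets)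
  qed
qed

text \<open>
  Two cylinders lift to a common level, where they are preimages of sets of one \<open>\<sigma>\<close>-algebra.
\<close>

lemma algebra_cylinders: "algebra (space Y) cylinders"
  unfolding algebra_iff_Un
proof (intro conjI ballI)
  show "cylinders \<subseteq> Pow (space Y)" by (auto simp: cylinders_def)
  show "{} \<in> cylinders" by (auto simp: cylinders_def intro!: exI[of _ "{}"])
next
  fix U assume "U \<in> cylinders"
  then obtain n \<sigma> where \<sigma>: "\<sigma> \<in> sets (X n)" "U = \<epsilon> n -` \<sigma> \<inter> space Y"
    by (auto simp: cylinders_def)
  then have "space Y - U = \<epsilon> n -` (space (X n) - \<sigma>) \<inter> space Y"
    using measurable_space[OF \<epsilon>_measurable] by auto
  then show "space Y - U \<in> cylinders" using \<sigma>(1) by (auto simp: cylinders_def)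
next
  fix U V assume "U \<in> cylinders" "V \<in> cylinders"
  then obtain n1 n2 where "\<And>m. m \<ge> n1 \<Longrightarrow> \<exists>\<sigma>\<in>sets (X m). U = \<epsilon> m -` \<sigma> \<inter> space Y"
      "\<And>m. m \<ge> n2 \<Longrightarrow> \<exists>\<sigma>\<in>sets (X m). V = \<epsilon> m -` \<sigma> \<inter> space Y"
    by (metis cylinder_at_later_level)
  then obtain \<sigma> \<tau> where "\<sigma> \<in> sets (X (max n1 n2))" "U = \<epsilon> (max n1 n2) -` \<sigma> \<inter> space Y"
      "\<tau> \<in> sets (X (max n1 n2))" "V = \<epsilon> (max n1 n2) -` \<tau> \<inter> space Y"
    by (meson max.cobounded1 max.cobounded2)
  then have "U \<union> V = \<epsilon> (max n1 n2) -` (\<sigma> \<union> \<tau>) \<inter> space Y" "\<sigma> \<union> \<tau> \<in> sets (X (max n1 n2))"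
    by auto
  then show "U \<union> V \<in> cylinders" unfolding cylinders_def by blast
qed

lemma sets_Y_cylinders: "sets Y = sigma_sets (space Y) cylinders"
  unfolding cylinders_def by (rule sets_target)

text \<open>
  Level 0 is \<open>\<sigma>\<close>-finite, and \<open>\<epsilon> 0\<close> preserves measures, so the target space is \<open>\<sigma>\<close>-finite by cylinders.
\<close>

lemma exhaustion_by_cylinders:
  obtains E :: "nat \<Rightarrow> 'b set" where "incseq E" "\<And>i. E i \<in> cylinders" "(\<Union>i. E i) = space Y"
    "\<And>i. emeasure Y (E i) \<noteq> \<infinity>"
proof -
  interpret sigma_finite_measure "X 0" by (rule sigma_finite)
  obtain F :: "nat \<Rightarrow> 'a set" where F: "range F \<subseteq> sets (X 0)" "(\<Union>i. F i) = space (X 0)"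
      "\<And>i. emeasure (X 0) (F i) \<noteq> \<infinity>" "incseq F"
    by (rule sigma_finite_incseq) blast
  show ?thesis
  proof (rule that[of "\<lambda>i. \<epsilon> 0 -` F i \<inter> space Y"])
    show "incseq (\<lambda>i. \<epsilon> 0 -` F i \<inter> space Y)" using F(4) by (auto simp: incseq_def)
    show "\<epsilon> 0 -` F i \<inter> space Y \<in> cylinders" for i using F(1) unfolding cylinders_def by blast
    show "(\<Union>i. \<epsilon> 0 -` F i \<inter> space Y) = space Y"
      using F(2) measurable_space[OF \<epsilon>_measurable, of _ 0] by blast
    show "emeasure Y (\<epsilon> 0 -` F i \<inter> space Y) \<noteq> \<infinity>" for i
      using F(1) F(3)[of i] emeasure_distr[OF \<epsilon>_measurable, of "F i" 0] by (auto simp: distr_\<epsilon>)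
  qed
qed

lemma
  assumes f: "square_integrable (X k) f"
  shows square_integrable_\<epsilon>: "square_integrable Y (\<lambda>y. f (\<epsilon> k y))"
    and \<Delta>_eq: "comp_op (X k) Y (\<epsilon> k) (ae_class (X k) f) = Some (ae_class Y (\<lambda>y. f (\<epsilon> k y)))"
proof -
  have le: "distr Y (X k) (\<epsilon> k) \<le> scale_measure (ennreal 1) (X k)" by (simp add: distr_\<epsilon>)
  show "square_integrable Y (\<lambda>y. f (\<epsilon> k y))" by (rule square_integrable_comp[OF \<epsilon>_measurable le _ f]) simp
  show "comp_op (X k) Y (\<epsilon> k) (ae_class (X k) f) = Some (ae_class Y (\<lambda>y. f (\<epsilon> k y)))"
    by (rule comp_op_dominated[OF \<epsilon>_measurable le _ f]) simp
qed

lemma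
  assumes km: "k \<le> m" and f: "square_integrable (X k) f"
  shows square_integrable_\<delta>: "square_integrable (X m) (\<lambda>x. f (\<delta> k m x))"
    and \<Delta>'_eq: "comp_op (X k) (X m) (\<delta> k m) (ae_class (X k) f) = Some (ae_class (X m) (\<lambda>x. f (\<delta> k m x)))"
proof -
  have le: "distr (X m) (X k) (\<delta> k m) \<le> scale_measure (ennreal 1) (X k)" by (simp add: distr_\<delta> km)
  show "square_integrable (X m) (\<lambda>x. f (\<delta> k m x))"
    by (rule square_integrable_comp[OF \<delta>_measurable[OF km] le _ f]) simp
  show "comp_op (X k) (X m) (\<delta> k m) (ae_class (X k) f) = Some (ae_class (X m) (\<lambda>x. f (\<delta> k m x)))"
    by (rule comp_op_dominated[OF \<delta>_measurable[OF km] le _ f]) simp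
qed

text \<open>
  The union of the images of the L2 spaces of the levels under their isometric embeddings. This is the
  set \<open>D\<^sub>\<infinity>\<close> of the inductive limit when the operator at each level is everywhere defined.
\<close>

definition level_classes :: "('b \<Rightarrow> complex) set set" where
  "level_classes = {ae_class Y (\<lambda>y. f (\<epsilon> k y)) | k f. square_integrable (X k) f}"

text \<open>
  By induction on \<open>g\<close>: the indicator of a set of finite measure is approximated by that of a cylinder,
  and the sum of functions from two levels is a function from the larger of the two.
\<close>

lemma approx_by_level_function:
  assumes "square_integrable Y g" and "e > 0"
  shows "\<exists>k f. square_integrable (X k) f \<and> seminorm2 Y (\<lambda>y. g y - f (\<epsilon> k y)) < e"
  using assms
proof (induction arbitrary: e rule: square_integrable_induct)
  case (indicator S)
  obtain E :: "nat \<Rightarrow> 'b set" where E: "incseq E" "\<And>i. E i \<in> cylinders" "(\<Union>i. E i) = space Y"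
    "\<And>i. emeasure Y (E i) \<noteq> \<infinity>" by (rule exhaustion_by_cylinders) blast
  \<comment> \<open>the norm of a difference of indicators is the square root of a measure, hence \<open>e\<^sup>2\<close>\<close>
  have "\<exists>U\<in>cylinders. emeasure Y U \<noteq> \<infinity> \<and> measure Y (sym_diff S U) < e\<^sup>2"
    by (rule algebra_approximates_finite_measure_set[OF algebra_cylinders sets_Y_cylinders E])
      (use indicator in auto)
  then obtain U where U: "U \<in> cylinders" "emeasure Y U \<noteq> \<infinity>" "measure Y (sym_diff S U) < e\<^sup>2" by auto
  then obtain k \<sigma> where \<sigma>: "\<sigma> \<in> sets (X k)" "U = \<epsilon> k -` \<sigma> \<inter> space Y" by (auto simp: cylinders_def)
  have "emeasure (X k) \<sigma> < \<infinity>"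
    using U(2) \<sigma> emeasure_distr[OF \<epsilon>_measurable \<sigma>(1)] by (simp add: distr_\<epsilon> less_top)
  then have "square_integrable (X k) (indicator \<sigma>)" by (simp add: square_integrable_indicator \<sigma>(1))
  moreover have "seminorm2 Y (\<lambda>y. indicator S y - indicator \<sigma> (\<epsilon> k y)) < e"
  proof -
    have "seminorm2 Y (\<lambda>y. indicator S y - indicator \<sigma> (\<epsilon> k y))
        = seminorm2 Y (\<lambda>y. indicator S y - indicator U y)"
      by (rule seminorm2_cong) (simp add: \<sigma>(2) indicator_def)
    also have "\<dots> = sqrt (measure Y (sym_diff S U))"
      using indicator(1) \<sigma> \<epsilon>_measurable[of k] by (intro seminorm2_indicator_diff) auto
    also have "\<dots> < e" using U(3) \<open>e > 0\<close> by (intro real_less_lsqrt) auto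
    finally show ?thesis .
  qed
  ultimately show ?case by blast
next
  case (scale a g)
  \<comment> \<open>dividing by \<open>cmod a + 1\<close> covers \<open>a = 0\<close> as well\<close>
  have "cmod a + 1 > 0" by (simp add: add_nonneg_pos)
  then obtain k f where f: "square_integrable (X k) f"
      "seminorm2 Y (\<lambda>y. g y - f (\<epsilon> k y)) < e / (cmod a + 1)"
    using scale.IH[of "e / (cmod a + 1)"] \<open>e > 0\<close> by auto
  have "seminorm2 Y (\<lambda>y. a * g y - a * f (\<epsilon> k y)) = cmod a * seminorm2 Y (\<lambda>y. g y - f (\<epsilon> k y))"
    by (simp add: seminorm2_scale[symmetric] right_diff_distrib)
  also have "\<dots> \<le> (cmod a + 1) * seminorm2 Y (\<lambda>y. g y - f (\<epsilon> k y))"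
    by (intro mult_right_mono) (auto simp: seminorm2_nonneg)
  also have "\<dots> < e" using f(2) \<open>cmod a + 1 > 0\<close> by (simp add: field_simps)
  finally show ?case using square_integrable_scale[OF f(1), of a] by blast
next
  case (add g1 g2)
  obtain k1 f1 where f1: "square_integrable (X k1) f1" "seminorm2 Y (\<lambda>y. g1 y - f1 (\<epsilon> k1 y)) < e / 2"
    using add.IH(1)[of "e / 2"] add.prems by auto
  obtain k2 f2 where f2: "square_integrable (X k2) f2" "seminorm2 Y (\<lambda>y. g2 y - f2 (\<epsilon> k2 y)) < e / 2"
    using add.IH(2)[of "e / 2"] add.prems by auto
  define m where "m = max k1 k2"
  have m: "k1 \<le> m" "k2 \<le> m" by (auto simp: m_def)
  define f where "f x = f1 (\<delta> k1 m x) + f2 (\<delta> k2 m x)" for x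
  have "square_integrable (X m) f"
    unfolding f_def by (intro square_integrable_add square_integrable_\<delta> m f1 f2)
  moreover have "seminorm2 Y (\<lambda>y. g1 y + g2 y - f (\<epsilon> m y)) < e"
  proof -
    have "seminorm2 Y (\<lambda>y. g1 y + g2 y - f (\<epsilon> m y))
        = seminorm2 Y (\<lambda>y. (g1 y - f1 (\<epsilon> k1 y)) + (g2 y - f2 (\<epsilon> k2 y)))"
      using \<epsilon>_comp m by (intro seminorm2_cong) (auto simp: f_def)
    also have "\<dots> \<le> seminorm2 Y (\<lambda>y. g1 y - f1 (\<epsilon> k1 y)) + seminorm2 Y (\<lambda>y. g2 y - f2 (\<epsilon> k2 y))"
      by (intro seminorm2_add_le square_integrable_diff square_integrable_\<epsilon> f1 f2 add.hyps)
    also have "\<dots> < e" using f1(2) f2(2) by simp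
    finally show ?thesis .
  qed
  ultimately show ?case by blast
next
  case (approx g)
  obtain h where h: "square_integrable Y h" "seminorm2 Y (\<lambda>y. g y - h y) < e / 2"
      "\<exists>k f. square_integrable (X k) f \<and> seminorm2 Y (\<lambda>y. h y - f (\<epsilon> k y)) < e / 2"
    using approx.IH[of "e / 2"] \<open>e > 0\<close> by (meson half_gt_zero)
  then obtain k f where f: "square_integrable (X k) f" "seminorm2 Y (\<lambda>y. h y - f (\<epsilon> k y)) < e / 2"
    by auto
  have "seminorm2 Y (\<lambda>y. g y - f (\<epsilon> k y)) < e"
    using seminorm2_diff_triangle[OF approx.hyps h(1) square_integrable_\<epsilon>[OF f(1)]] h(2) f(2) by simp
  with f(1) show ?case by blast
qed

lemma level_classes_subset: "level_classes \<subseteq> L2 Y"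
  by (auto simp: level_classes_def intro: ae_class_in_L2 square_integrable_\<epsilon>)

lemma level_classes_dense: "L2_topology Y closure_of level_classes = L2 Y"
proof -
  have "\<exists>H\<in>level_classes. H \<in> L2 Y \<and> L2_dist Y G H < r" if G: "G \<in> L2 Y" and "r > 0" for G r
  proof -
    obtain g where g: "square_integrable Y g" "G = ae_class Y g" using G by (rule L2_cases)
    obtain k f where f: "square_integrable (X k) f" "seminorm2 Y (\<lambda>y. g y - f (\<epsilon> k y)) < r"
      using approx_by_level_function[OF g(1) \<open>r > 0\<close>] by auto
    then have "ae_class Y (\<lambda>y. f (\<epsilon> k y)) \<in> level_classes" by (auto simp: level_classes_def)
    then show ?thesis
      using f g level_classes_subset square_integrable_\<epsilon>[OF f(1)]
      by (intro bexI[of _ "ae_class Y (\<lambda>y. f (\<epsilon> k y))"]) (auto simp: L2_dist_ae_class)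
  qed
  then show ?thesis
    unfolding L2_topology_def Metric_space.metric_closure_of[OF Metric_space_L2]
    by (auto simp: Metric_space.in_mball[OF Metric_space_L2])
qed

end

section \<open>The inductive limit of composition operators\<close>

text \<open>
  The two hypotheses on the densities, existence and uniform boundedness, enter only through the
  domination of the image measures by one finite multiple \<open>c\<close>.
\<close>

locale convergent_transformations = isometric_target_space X \<delta> Y \<epsilon>
  for X :: "nat \<Rightarrow> 'a measure" and \<delta> :: "nat \<Rightarrow> nat \<Rightarrow> 'a \<Rightarrow> 'a"
    and Y :: "'b measure" and \<epsilon> :: "nat \<Rightarrow> 'b \<Rightarrow> 'a" +
  fixes A :: "nat \<Rightarrow> 'a \<Rightarrow> 'a" and B :: "'b \<Rightarrow> 'b" and c :: real
  assumes A_measurable: "\<And>n. A n \<in> X n \<rightarrow>\<^sub>M X n"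
    and B_measurable: "B \<in> Y \<rightarrow>\<^sub>M Y"
    and c_nonneg: "0 \<le> c"
    and distr_A: "\<And>n. distr (X n) (X n) (A n) \<le> scale_measure (ennreal c) (X n)"
    and preimages_tendsto: "\<And>k \<sigma>. \<sigma> \<in> sets (X k) \<Longrightarrow>
      (\<lambda>n. emeasure Y (sym_diff ((\<delta> k n \<circ> A n \<circ> \<epsilon> n) -` \<sigma> \<inter> space Y)
                                ((\<epsilon> k \<circ> B) -` \<sigma> \<inter> space Y))) \<longlonglongrightarrow> 0"
begin

lemma level_map_measurable: "k \<le> n \<Longrightarrow> \<delta> k n \<circ> A n \<circ> \<epsilon> n \<in> Y \<rightarrow>\<^sub>M X k"
  by (intro measurable_comp[OF \<epsilon>_measurable] measurable_comp[OF A_measurable] \<delta>_measurable)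

text \<open>
  The maps \<open>\<epsilon> n\<close> and \<open>\<delta> k n\<close> preserve measures, so the bound for \<open>A n\<close> is inherited with the same
  constant at every level.
\<close>

lemma distr_level_map:
  assumes "k \<le> n"
  shows "distr Y (X k) (\<delta> k n \<circ> A n \<circ> \<epsilon> n) \<le> scale_measure (ennreal c) (X k)"
proof -
  note [measurable] = \<delta>_measurable[OF assms] A_measurable[of n] \<epsilon>_measurable[of n]
  have "emeasure (distr Y (X k) (\<delta> k n \<circ> A n \<circ> \<epsilon> n)) S \<le> c * emeasure (X k) S"
    if S[measurable]: "S \<in> sets (X k)" for S
  proof -
    let ?S = "\<delta> k n -` S \<inter> space (X n)"
    have "emeasure (distr Y (X k) (\<delta> k n \<circ> A n \<circ> \<epsilon> n)) S
        = emeasure (distr (distr (distr Y (X n) (\<epsilon> n)) (X n) (A n)) (X k) (\<delta> k n)) S"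
      by (simp add: distr_distr o_assoc)
    also have "\<dots> = emeasure (distr (X n) (X n) (A n)) ?S"
      by (simp add: distr_\<epsilon> emeasure_distr)
    also have "\<dots> \<le> c * emeasure (X n) ?S"
      using le_measureD3[OF distr_A[of n], of ?S] by simp
    also have "emeasure (X n) ?S = emeasure (distr (X n) (X k) (\<delta> k n)) S"
      by (simp add: emeasure_distr)
    finally show ?thesis by (simp add: distr_\<delta>[OF assms] o_def)
  qed
  then show ?thesis by (rule distr_le_scale_measureI)
qed

text \<open>
  The preimage under \<open>\<epsilon> k \<circ> B\<close> differs from the one under the level map \<open>\<delta> k n \<circ> A n \<circ> \<epsilon> n\<close> by a set
  whose measure vanishes as \<open>n\<close> grows, while the latter preimages obey a bound uniform in \<open>n\<close>.
\<close>

lemma emeasure_B_preimage_cylinder: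
  assumes S[measurable]: "S \<in> sets (X k)"
  shows "emeasure Y ((\<epsilon> k \<circ> B) -` S \<inter> space Y) \<le> c * emeasure (X k) S"
proof -
  note [measurable] = B_measurable \<epsilon>_measurable[of k]
  let ?P = "\<lambda>n. (\<delta> k n \<circ> A n \<circ> \<epsilon> n) -` S \<inter> space Y" and ?Q = "(\<epsilon> k \<circ> B) -` S \<inter> space Y"
  have bound: "emeasure Y ?Q \<le> c * emeasure (X k) S + emeasure Y (sym_diff (?P n) ?Q)" if "n \<ge> k" for n
  proof -
    note [measurable] = level_map_measurable[OF that]
    have "emeasure Y ?Q \<le> emeasure Y (?P n \<union> sym_diff (?P n) ?Q)"
      by (intro emeasure_mono) auto
    also have "\<dots> \<le> emeasure Y (?P n) + emeasure Y (sym_diff (?P n) ?Q)"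
      by (intro emeasure_subadditive) measurable
    also have "emeasure Y (?P n) \<le> c * emeasure (X k) S"
      using le_measureD3[OF distr_level_map[OF that], of S] by (simp add: emeasure_distr)
    finally show ?thesis by (simp add: add_right_mono o_def)
  qed
  have "(\<lambda>n. c * emeasure (X k) S + emeasure Y (sym_diff (?P n) ?Q)) \<longlonglongrightarrow> c * emeasure (X k) S + 0"
    by (intro tendsto_intros preimages_tendsto S)
  then show ?thesis using bound by (auto intro: LIMSEQ_le_const)
qed

text \<open>
  The bound just shown concerns cylinders only; comparison of measures on the generating algebra
  carries it to all measurable sets. This yields both nonsingularity of \<open>B\<close> and boundedness of its
  composition operator.
\<close>

lemma distr_B: "distr Y Y B \<le> scale_measure (ennreal c) Y"
proof -
  obtain E :: "nat \<Rightarrow> 'b set" where E: "incseq E" "\<And>i. E i \<in> cylinders" "(\<Union>i. E i) = space Y"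
    "\<And>i. emeasure Y (E i) \<noteq> \<infinity>" by (rule exhaustion_by_cylinders) blast
  show ?thesis
  proof (rule le_measure_if_le_on_algebra[OF algebra_cylinders _ _ _ E(1-3)])
    show "sets (distr Y Y B) = sigma_sets (space Y) cylinders"
        "sets (scale_measure (ennreal c) Y) = sigma_sets (space Y) cylinders"
      by (simp_all add: sets_Y_cylinders)
    show "emeasure (scale_measure (ennreal c) Y) (E i) \<noteq> \<infinity>" for i
      using E(4)[of i] by (simp add: ennreal_mult_eq_top_iff)
    fix U assume "U \<in> cylinders"
    then obtain k \<sigma> where \<sigma>: "\<sigma> \<in> sets (X k)" "U = \<epsilon> k -` \<sigma> \<inter> space Y"
      by (auto simp: cylinders_def)
    have U: "U \<in> sets Y" using \<sigma> \<epsilon>_measurable[of k] by simp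
    have "emeasure (distr Y Y B) U = emeasure Y ((\<epsilon> k \<circ> B) -` \<sigma> \<inter> space Y)"
      unfolding emeasure_distr[OF B_measurable U] unfolding \<sigma>(2)
      using measurable_space[OF B_measurable] by (intro arg_cong[of _ _ "emeasure Y"]) auto
    also have "\<dots> \<le> c * emeasure (X k) \<sigma>" by (rule emeasure_B_preimage_cylinder[OF \<sigma>(1)])
    also have "emeasure (X k) \<sigma> = emeasure Y U"
      using emeasure_distr[OF \<epsilon>_measurable \<sigma>(1)] by (simp add: distr_\<epsilon> \<sigma>(2))
    finally show "emeasure (distr Y Y B) U \<le> emeasure (scale_measure (ennreal c) Y) U" by simp
  qed
qed

lemma distr_\<epsilon>_B: "distr Y (X k) (\<epsilon> k \<circ> B) \<le> scale_measure (ennreal c) (X k)"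
proof -
  have m: "\<epsilon> k \<circ> B \<in> Y \<rightarrow>\<^sub>M X k" by (rule measurable_comp[OF B_measurable \<epsilon>_measurable])
  show ?thesis
    using emeasure_B_preimage_cylinder[of _ k]
    by (intro distr_le_scale_measureI) (simp add: emeasure_distr[OF m])
qed

lemma level_functions_converge:
  assumes f: "square_integrable (X k) f"
  shows "(\<lambda>n. seminorm2 Y (\<lambda>y. f (\<delta> k n (A n (\<epsilon> n y))) - f (\<epsilon> k (B y)))) \<longlonglongrightarrow> 0"
\<comment> \<open>\<open>\<delta> k n\<close> is a map between the levels only for \<open>n \<ge> k\<close>, so the sequence is shifted\<close>
proof (rule LIMSEQ_offset[of _ k])
  let ?\<phi> = "\<lambda>n. \<delta> k (n + k) \<circ> A (n + k) \<circ> \<epsilon> (n + k)"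
  have "(\<lambda>n. seminorm2 Y (\<lambda>y. f (?\<phi> n y) - f ((\<epsilon> k \<circ> B) y))) \<longlonglongrightarrow> 0"
  proof (rule comp_tendsto_if_preimages_tendsto[OF _ _ _ distr_\<epsilon>_B c_nonneg _ f])
    show "?\<phi> n \<in> Y \<rightarrow>\<^sub>M X k" "distr Y (X k) (?\<phi> n) \<le> scale_measure (ennreal c) (X k)" for n
      by (rule level_map_measurable distr_level_map; simp)+
    show "\<epsilon> k \<circ> B \<in> Y \<rightarrow>\<^sub>M X k" by (rule measurable_comp[OF B_measurable \<epsilon>_measurable])
    fix S assume "S \<in> sets (X k)"
    from LIMSEQ_ignore_initial_segment[OF preimages_tendsto[OF this], of k]
    show "(\<lambda>n. measure Y (sym_diff (?\<phi> n -` S \<inter> space Y) ((\<epsilon> k \<circ> B) -` S \<inter> space Y))) \<longlonglongrightarrow> 0"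
      unfolding measure_def by (intro tendsto_enn2real) simp_all
  qed
  then show "(\<lambda>n. seminorm2 Y (\<lambda>y. f (\<delta> k (n + k) (A (n + k) (\<epsilon> (n + k) y))) - f (\<epsilon> k (B y)))) \<longlonglongrightarrow> 0"
    by simp
qed

text \<open>
  Every operator at level \<open>m\<close> is everywhere defined, so the only condition for membership in the
  domain is that the limit exists. It always does, by convergence of the level functions, and it is
  the class of \<open>f \<circ> \<epsilon> k \<circ> B\<close>, the composition of \<open>f \<circ> \<epsilon> k\<close> with \<open>B\<close>.
\<close>

lemma has_inductive_limit_iff:
  "has_inductive_limit X \<delta> Y \<epsilon> (\<lambda>n. composition_operator (X n) (A n)) G H \<longleftrightarrow>
    G \<in> level_classes \<and> H = the (composition_operator Y B G)"
proof -
  let ?C = "\<lambda>n. composition_operator (X n) (A n)"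
  let ?\<Delta> = "\<lambda>k F. the (comp_op (X k) Y (\<epsilon> k) F)"
  let ?\<Delta>' = "\<lambda>k m F. the (comp_op (X k) (X m) (\<delta> k m) F)"
  have C: "?C m (?\<Delta>' k m (ae_class (X k) f)) = Some (ae_class (X m) (\<lambda>x. f (\<delta> k m (A m x))))"
    and sq: "square_integrable (X m) (\<lambda>x. f (\<delta> k m (A m x)))"
    if "square_integrable (X k) f" "k \<le> m" for k m f
    using square_integrable_\<delta>[OF that(2,1)] \<Delta>'_eq[OF that(2,1)]
      comp_op_dominated[OF A_measurable distr_A c_nonneg] square_integrable_comp[OF A_measurable distr_A c_nonneg]
    by auto
  have in_dom: "\<exists>m\<^sub>0\<ge>k. \<forall>m\<ge>m\<^sub>0. ?\<Delta>' k m (ae_class (X k) f) \<in> dom (?C m)"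
    if "square_integrable (X k) f" for k f
    using C[OF that] by (intro exI[of _ k]) auto
  have lim: "limitin (L2_topology Y) (\<lambda>m. ?\<Delta> m (the (?C m (?\<Delta>' k m (ae_class (X k) f)))))
      (ae_class Y (\<lambda>y. f (\<epsilon> k (B y)))) sequentially"
    if f: "square_integrable (X k) f" for k f
  proof (rule limitin_L2_topology_ae_class[of _ _ k])
    show "square_integrable Y (\<lambda>y. f (\<epsilon> k (B y)))"
      by (rule square_integrable_comp[OF B_measurable distr_B c_nonneg square_integrable_\<epsilon>[OF f]])
    show "square_integrable Y (\<lambda>y. f (\<delta> k m (A m (\<epsilon> m y))))" if "k \<le> m" for m
      by (rule square_integrable_\<epsilon>[OF sq[OF f that]])
    show "?\<Delta> m (the (?C m (?\<Delta>' k m (ae_class (X k) f)))) = ae_class Y (\<lambda>y. f (\<delta> k m (A m (\<epsilon> m y))))"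
      if "k \<le> m" for m
      by (simp add: C[OF f that] \<Delta>_eq[OF sq[OF f that]])
    show "(\<lambda>m. seminorm2 Y (\<lambda>y. f (\<delta> k m (A m (\<epsilon> m y))) - f (\<epsilon> k (B y)))) \<longlonglongrightarrow> 0"
      by (rule level_functions_converge[OF f])
  qed
  have B: "the (composition_operator Y B (ae_class Y (\<lambda>y. f (\<epsilon> k y)))) = ae_class Y (\<lambda>y. f (\<epsilon> k (B y)))"
    if "square_integrable (X k) f" for k f
    using comp_op_dominated[OF B_measurable distr_B c_nonneg square_integrable_\<epsilon>[OF that]] by simp
  show ?thesis
  proof
    assume "has_inductive_limit X \<delta> Y \<epsilon> ?C G H"
    then obtain k F where F: "F \<in> L2 (X k)" "G = ?\<Delta> k F"
        "limitin (L2_topology Y) (\<lambda>m. ?\<Delta> m (the (?C m (?\<Delta>' k m F)))) H sequentially"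
      unfolding has_inductive_limit_def Let_def by blast
    obtain f where f: "square_integrable (X k) f" "F = ae_class (X k) f" using F(1) by (rule L2_cases)
    have "H = ae_class Y (\<lambda>y. f (\<epsilon> k (B y)))"
      using limitin_Hausdorff_unique[OF F(3)[unfolded f(2)] lim[OF f(1)] _ Hausdorff_space_L2_topology] by simp
    moreover have G: "G = ae_class Y (\<lambda>y. f (\<epsilon> k y))" by (simp add: F(2) f \<Delta>_eq)
    ultimately show "G \<in> level_classes \<and> H = the (composition_operator Y B G)"
      using f(1) B by (auto simp: level_classes_def)
  next
    assume "G \<in> level_classes \<and> H = the (composition_operator Y B G)"
    then obtain k f where f: "square_integrable (X k) f" "G = ae_class Y (\<lambda>y. f (\<epsilon> k y))"
        "H = ae_class Y (\<lambda>y. f (\<epsilon> k (B y)))"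
      using B by (auto simp: level_classes_def)
    have "G = ?\<Delta> k (ae_class (X k) f)" by (simp add: f \<Delta>_eq)
    then show "has_inductive_limit X \<delta> Y \<epsilon> ?C G H"
      unfolding has_inductive_limit_def Let_def
      using ae_class_in_L2[OF f(1)] in_dom[OF f(1)] lim[OF f(1)] f(3) by blast
  qed
qed

lemma inductive_limit_eq_restriction:
  "inductive_limit X \<delta> Y \<epsilon> (\<lambda>n. composition_operator (X n) (A n))
    = composition_operator Y B |` level_classes"
proof
  fix G
  have "\<exists>H. composition_operator Y B G = Some H" if "G \<in> level_classes"
    using that level_classes_subset dom_comp_op_dominated[OF B_measurable distr_B c_nonneg] by blast
  then show "inductive_limit X \<delta> Y \<epsilon> (\<lambda>n. composition_operator (X n) (A n)) G
      = (composition_operator Y B |` level_classes) G"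
    unfolding inductive_limit_def has_inductive_limit_iff by (cases "G \<in> level_classes") auto
qed

end

theorem theorem4p12:
  fixes X :: "nat \<Rightarrow> 'a measure" and \<delta> :: "nat \<Rightarrow> nat \<Rightarrow> 'a \<Rightarrow> 'a"
    and Y :: "'b measure" and \<epsilon> :: "nat \<Rightarrow> 'b \<Rightarrow> 'a"
    and A :: "nat \<Rightarrow> 'a \<Rightarrow> 'a" and B :: "'b \<Rightarrow> 'b"
  assumes "isometric_target_space X \<delta> Y \<epsilon>"
    and "\<And>n. A n \<in> X n \<rightarrow>\<^sub>M X n"
    and "\<And>n. nonsingular (X n) (A n)"
    and "B \<in> Y \<rightarrow>\<^sub>M Y"
    and "\<And>k \<sigma>. \<sigma> \<in> sets (X k) \<Longrightarrow>
      (\<lambda>n. emeasure Y (sym_diff ((\<delta> k n \<circ> A n \<circ> \<epsilon> n) -` \<sigma> \<inter> space Y)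
                                ((\<epsilon> k \<circ> B) -` \<sigma> \<inter> space Y))) \<longlonglongrightarrow> 0"
    and "(SUP n. esssup (X n) (RN_density (X n) (A n))) < \<infinity>"
  shows "nonsingular Y B \<and>
    bounded_on_L2 Y (composition_operator Y B) \<and>
    is_operator_closure Y (composition_operator Y B)
      (inductive_limit X \<delta> Y \<epsilon> (\<lambda>n. composition_operator (X n) (A n)))"
proof -
  interpret isometric_target_space X \<delta> Y \<epsilon> by fact
  obtain c where c: "0 \<le> c" "(SUP n. esssup (X n) (RN_density (X n) (A n))) = ennreal c"
    using assms(6) by (cases "SUP n. esssup (X n) (RN_density (X n) (A n))") auto
  have "distr (X n) (X n) (A n) \<le> scale_measure (ennreal c) (X n)" for n
    unfolding c(2)[symmetric]
    by (intro distr_le_if_RN_density_bounded sigma_finite assms SUP_upper) simp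
  then interpret convergent_transformations X \<delta> Y \<epsilon> A B c
    using assms c(1) by unfold_locales
  note dominated = B_measurable distr_B c_nonneg
  have "nonsingular Y B"
    unfolding nonsingular_def by (rule absolutely_continuous_if_dominated[OF distr_B])
  moreover have "bounded_on_L2 Y (composition_operator Y B)"
    by (rule bounded_on_L2_comp_op[OF dominated])
  moreover have "is_operator_closure Y (composition_operator Y B)
      (inductive_limit X \<delta> Y \<epsilon> (\<lambda>n. composition_operator (X n) (A n)))"
    unfolding inductive_limit_eq_restriction
    by (rule is_operator_closure_restrict_dense[OF dom_comp_op_dominated[OF dominated]
      continuous_map_comp_op[OF dominated] level_classes_subset level_classes_dense])
  ultimately show ?thesis by blast
qed

end
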